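(* Let $\tau\in\mathbb{C}$ with $\mathrm{Im}(\tau)>0$ and $q=e^{2i\pi\tau}$ (with $q^{s}=e^{2i\pi\tau s}$). Then, as meromorphic functions of $z\in\mathbb{C}$, $$SD(z,\tau)=\sin(\pi z)\,q^{1/4}\prod_{n=0}^{+\infty}(1-q^{2n+2})^2(1-q^{n+1/2})^2\prod_{n=0}^{+\infty}\frac{\left(1-e^{2i\pi z}q^{n+1}\right)\left(1-e^{-2i\pi z}q^{n+1}\right)}{\left(1+e^{2i\pi z}q^{n+1/2}\right)\left(1+e^{-2i\pi z}q^{n+1/2}\right)}.$$
   Context: The function $z\mapsto SD(z,\tau)$ is the meromorphic function on $\mathbb{C}$ (the renormalized Jacobi function $\mathrm{sd}$) which for $z=x+y\tau$ ($x,y\in\mathbb{R}$) is given by $$SD(z,\tau)=\frac12\sum_{n=0}^{+\infty}\frac{(-1)^n\sin((2n+1)\pi z)}{\cos((n+\frac12)\pi\tau)}\ \text{ when }|y|<\tfrac12,\qquad SD(z,\tau)=-\frac{1}{2\tau}\sum_{n=0}^{+\infty}\frac{(-1)^n\sin((2n+1)\pi z/\tau)}{\cos((n+\frac12)\pi/\tau)}\ \text{ when }|x|<\tfrac12 .$$ *)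

theory Defs
  imports "HOL-Complex_Analysis.Complex_Analysis"
begin

text \<open>
  The power \<open>q\<^sup>s\<close> of the nome \<open>q = exp (2 i \<pi> \<tau>)\<close>. It depends on \<open>\<tau>\<close> and not only on \<open>q\<close>,
  so it is not \<open>q powr s\<close>, which uses the principal branch of the logarithm.
\<close>
definition nome_pow :: "complex \<Rightarrow> real \<Rightarrow> complex" where
  "nome_pow \<tau> s = exp (2 * \<i> * of_real pi * \<tau> * of_real s)"

definition SD_term1 :: "complex \<Rightarrow> complex \<Rightarrow> nat \<Rightarrow> complex" where
  "SD_term1 \<tau> z n =
     (-1) ^ n * sin ((2 * of_nat n + 1) * of_real pi * z)
       / cos ((of_nat n + 1/2) * of_real pi * \<tau>)"

definition SD_term2 :: "complex \<Rightarrow> complex \<Rightarrow> nat \<Rightarrow> complex" where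
  "SD_term2 \<tau> z n =
     (-1) ^ n * sin ((2 * of_nat n + 1) * of_real pi * z / \<tau>)
       / cos ((of_nat n + 1/2) * of_real pi / \<tau>)"

text \<open>
  \<open>nicely_meromorphic_on\<close> fixes a representative of a meromorphic function: removable
  singularities are removed and the value at each pole is \<open>0\<close>. Two such functions on the plane
  are equal as meromorphic functions iff they are equal as HOL functions. Neither strip contains
  a pole, so the expansions hold at every point of the strips.
\<close>
definition is_SD :: "complex \<Rightarrow> (complex \<Rightarrow> complex) \<Rightarrow> bool" where
  "is_SD \<tau> f \<longleftrightarrow>
     f nicely_meromorphic_on UNIV \<and>
     (\<forall>x y :: real. \<bar>y\<bar> < 1/2 \<longrightarrow>
        (let z = of_real x + of_real y * \<tau> in
           summable (SD_term1 \<tau> z) \<and> f z = 1/2 * (\<Sum>n. SD_term1 \<tau> z n))) \<and>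
     (\<forall>x y :: real. \<bar>x\<bar> < 1/2 \<longrightarrow>
        (let z = of_real x + of_real y * \<tau> in
           summable (SD_term2 \<tau> z) \<and> f z = - (1 / (2 * \<tau>)) * (\<Sum>n. SD_term2 \<tau> z n)))"

definition SD :: "complex \<Rightarrow> complex \<Rightarrow> complex" where
  "SD z \<tau> = (THE f. is_SD \<tau> f) z"

text \<open>
  The factors of the two infinite products. At a pole of \<open>SD\<close> one denominator of \<open>prod_factor2\<close>
  vanishes; since \<open>x / 0 = 0\<close>, that factor and hence the product are \<open>0\<close> there, in accordance
  with the value of a nicely meromorphic function at its poles.
\<close>
definition prod_factor1 :: "complex \<Rightarrow> nat \<Rightarrow> complex" where
  "prod_factor1 \<tau> n =
     (1 - nome_pow \<tau> (2 * real n + 2))\<^sup>2 * (1 - nome_pow \<tau> (real n + 1/2))\<^sup>2"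

definition prod_factor2 :: "complex \<Rightarrow> complex \<Rightarrow> nat \<Rightarrow> complex" where
  "prod_factor2 \<tau> z n =
     ((1 - exp (2 * \<i> * of_real pi * z) * nome_pow \<tau> (real n + 1)) *
      (1 - exp (- 2 * \<i> * of_real pi * z) * nome_pow \<tau> (real n + 1))) /
     ((1 + exp (2 * \<i> * of_real pi * z) * nome_pow \<tau> (real n + 1/2)) *
      (1 + exp (- 2 * \<i> * of_real pi * z) * nome_pow \<tau> (real n + 1/2)))"

end

theory Submission
  imports Defs
begin

text \<open>
  Write \<open>r = exp (i \<pi> \<tau>)\<close>, \<open>q = r\<^sup>2\<close>, \<open>w = exp (i \<pi> z)\<close>. The product changes sign under \<open>z \<mapsto> z + 1\<close> and
  \<open>z \<mapsto> z + \<tau>\<close> and has simple poles exactly at \<open>1/2 + \<tau>/2 + m + n \<tau>\<close>; the constant in front is such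
  that the residue there is \<open>(-1) ^ (m + n) / (4 \<pi> i)\<close>, whatever \<open>\<tau>\<close> is. A function with these two
  antiperiods is determined by its residues: a difference is holomorphic and bounded, hence constant,
  hence \<open>0\<close>. The first series is a difference of two Lambert-type series with the functional equation
  \<open>L x + r L (q x) = 1 / (1 - x)\<close>, which continues it to a wider strip as an antiperiodic function
  with the same residues, so it equals the product. As the residues do not depend on \<open>\<tau>\<close>, the product
  for \<open>\<tau>\<close> at \<open>z\<close> is also \<open>- 1 / \<tau>\<close> times the product for \<open>- 1 / \<tau>\<close> at \<open>z / \<tau>\<close>, and the second series
  is the first one for \<open>- 1 / \<tau>\<close>.
\<close>

section \<open>The q-Pochhammer symbol\<close>

definition qpoch :: "complex \<Rightarrow> complex \<Rightarrow> complex" where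
  "qpoch q u = (\<Prod>n. 1 - u * q ^ n)"

lemma convergent_qpoch:
  fixes q u :: complex
  assumes "norm q < 1"
  shows "convergent_prod (\<lambda>n. 1 - u * q ^ n)"
proof (rule abs_convergent_prod_imp_convergent_prod)
  have "summable (\<lambda>n. norm u * norm q ^ n)"
    using assms by (intro summable_mult summable_geometric) auto
  then show "abs_convergent_prod (\<lambda>n. 1 - u * q ^ n)"
    unfolding abs_convergent_prod_conv_summable by (simp add: norm_mult norm_power)
qed

lemma qpoch_has_prod: "norm q < 1 \<Longrightarrow> (\<lambda>n. 1 - u * q ^ n) has_prod qpoch q u"
  unfolding qpoch_def by (intro convergent_prod_has_prod convergent_qpoch)

lemma qpoch_LIMSEQ:
  assumes "norm q < 1"
  shows "(\<lambda>N. \<Prod>n<N. 1 - u * q ^ n) \<longlonglongrightarrow> qpoch q u"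
  using convergent_prod_LIMSEQ[OF convergent_qpoch[OF assms, of u]]
  unfolding qpoch_def by (subst LIMSEQ_lessThan_iff_atMost)

lemma qpoch_rec:
  assumes "norm q < 1"
  shows "qpoch q u = (1 - u) * qpoch q (q * u)"
proof -
  have "(\<lambda>N. \<Prod>n<Suc N. 1 - u * q ^ n) \<longlonglongrightarrow> qpoch q u"
    using qpoch_LIMSEQ[OF assms] by (rule LIMSEQ_Suc)
  moreover have "(\<Prod>n<Suc N. 1 - u * q ^ n) = (1 - u) * (\<Prod>n<N. 1 - (q * u) * q ^ n)" for N
    by (subst prod.lessThan_Suc_shift) (simp add: mult_ac)
  ultimately have "(\<lambda>N. (1 - u) * (\<Prod>n<N. 1 - (q * u) * q ^ n)) \<longlonglongrightarrow> qpoch q u"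
    by simp
  moreover have "(\<lambda>N. (1 - u) * (\<Prod>n<N. 1 - (q * u) * q ^ n)) \<longlonglongrightarrow> (1 - u) * qpoch q (q * u)"
    by (intro tendsto_intros qpoch_LIMSEQ assms)
  ultimately show ?thesis by (rule LIMSEQ_unique)
qed

lemma qpoch_eq_0_iff:
  assumes "norm q < 1"
  shows "qpoch q u = 0 \<longleftrightarrow> (\<exists>n. u * q ^ n = 1)"
  using has_prod_eq_0_iff[OF qpoch_has_prod[OF assms, of u]] by (auto simp: image_iff)

lemma qpoch_nonzero:
  assumes "norm q < 1" "norm u < 1"
  shows "qpoch q u \<noteq> 0"
proof -
  have "u * q ^ n \<noteq> 1" for n
  proof -
    have "norm (u * q ^ n) = norm u * norm q ^ n"
      by (simp add: norm_mult norm_power)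
    also have "\<dots> \<le> norm u * 1"
      using assms by (intro mult_left_mono power_le_one) auto
    finally show ?thesis using assms by auto
  qed
  then show ?thesis using qpoch_eq_0_iff[OF assms(1)] by blast
qed

text \<open>The partial products converge uniformly on every closed ball of radius 1: for
  \<open>u\<close> in the ball, |u q^n| is at most (|z| + 1) |q|^n, a geometric majorant for the
  M-test.\<close>

lemma holomorphic_qpoch:
  assumes q: "norm q < 1"
  shows "qpoch q holomorphic_on UNIV"
proof (rule holomorphic_uniform_sequence)
  fix z :: complex
  let ?P = "\<lambda>N u. \<Prod>n<N. 1 - u * q ^ n"
  have "uniformly_convergent_on (cball z 1) ?P"
  proof (rule uniformly_convergent_on_prod')
    show "uniformly_convergent_on (cball z 1) (\<lambda>N u. \<Sum>n<N. norm (1 - u * q ^ n - 1))"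
    proof (rule Weierstrass_m_test')
      fix n u assume "u \<in> cball z 1"
      then have "norm u \<le> norm z + 1"
        using norm_triangle_ineq2[of u z] by (simp add: dist_norm norm_minus_commute)
      then show "norm (norm (1 - u * q ^ n - 1)) \<le> (norm z + 1) * norm q ^ n"
        by (simp add: norm_mult norm_power mult_right_mono)
    qed (use q in \<open>auto intro!: summable_mult summable_geometric\<close>)
  qed (auto intro!: continuous_intros)
  then obtain g where g: "uniform_limit (cball z 1) ?P g sequentially"
    by (auto simp: uniformly_convergent_on_def)
  also have "?this \<longleftrightarrow> uniform_limit (cball z 1) ?P (qpoch q) sequentially"
  proof (intro uniform_limit_cong)
    fix u assume "u \<in> cball z 1"
    then show "g u = qpoch q u"
      using tendsto_uniform_limitI[OF g] qpoch_LIMSEQ[OF q] LIMSEQ_unique by blast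
  qed auto
  finally show "\<exists>d>0. cball z d \<subseteq> UNIV \<and> uniform_limit (cball z d) ?P (qpoch q) sequentially"
    by (intro exI[of _ 1]) auto
qed (auto intro!: holomorphic_intros)

lemma analytic_qpoch [analytic_intros]:
  assumes "norm q < 1" "f analytic_on A"
  shows "(\<lambda>z. qpoch q (f z)) analytic_on A"
  using analytic_on_compose_gen[OF assms(2), of "qpoch q" UNIV] holomorphic_qpoch[OF assms(1)]
  by (auto simp: o_def analytic_on_open)

text \<open>The two symbols collect the factors of even and of odd index, so \<open>N\<close>
  factors of each make up the first \<open>2 * N\<close> factors on the right.\<close>

lemma qpoch_square:
  assumes q: "norm q < 1"
  shows "qpoch (q\<^sup>2) u * qpoch (q\<^sup>2) (q * u) = qpoch q u"
proof (rule LIMSEQ_unique)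
  have q2: "norm (q\<^sup>2) < 1"
    using q by (simp add: norm_power power_less_one_iff)
  show "(\<lambda>N. (\<Prod>n<N. 1 - u * (q\<^sup>2) ^ n) * (\<Prod>n<N. 1 - (q * u) * (q\<^sup>2) ^ n))
          \<longlonglongrightarrow> qpoch (q\<^sup>2) u * qpoch (q\<^sup>2) (q * u)"
    by (intro tendsto_mult qpoch_LIMSEQ q2)
  have "(\<Prod>n<N. 1 - u * (q\<^sup>2) ^ n) * (\<Prod>n<N. 1 - (q * u) * (q\<^sup>2) ^ n) = (\<Prod>n<2*N. 1 - u * q ^ n)" for N
    by (induction N) (simp_all add: power_mult[symmetric] algebra_simps)
  moreover have "(\<lambda>N. \<Prod>n<2*N. 1 - u * q ^ n) \<longlonglongrightarrow> qpoch q u"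
    by (rule filterlim_compose[OF qpoch_LIMSEQ[OF q]])
       (rule filterlim_subseq, simp add: strict_mono_def)
  ultimately show "(\<lambda>N. (\<Prod>n<N. 1 - u * (q\<^sup>2) ^ n) * (\<Prod>n<N. 1 - (q * u) * (q\<^sup>2) ^ n))
          \<longlonglongrightarrow> qpoch q u" by simp
qed

lemma qpoch_mult_uminus:
  assumes q: "norm q < 1"
  shows "qpoch q u * qpoch q (- u) = qpoch (q\<^sup>2) (u\<^sup>2)"
proof (rule LIMSEQ_unique)
  show "(\<lambda>N. (\<Prod>n<N. 1 - u * q ^ n) * (\<Prod>n<N. 1 - (- u) * q ^ n))
          \<longlonglongrightarrow> qpoch q u * qpoch q (- u)"
    by (intro tendsto_mult qpoch_LIMSEQ q)
  have "(\<Prod>n<N. 1 - u * q ^ n) * (\<Prod>n<N. 1 - (- u) * q ^ n) = (\<Prod>n<N. 1 - u\<^sup>2 * (q\<^sup>2) ^ n)" for N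
    unfolding prod.distrib[symmetric]
    by (intro prod.cong refl) (simp add: power2_eq_square algebra_simps power_mult_distrib)
  then show "(\<lambda>N. (\<Prod>n<N. 1 - u * q ^ n) * (\<Prod>n<N. 1 - (- u) * q ^ n))
          \<longlonglongrightarrow> qpoch (q\<^sup>2) (u\<^sup>2)"
    using qpoch_LIMSEQ[of "q\<^sup>2" "u\<^sup>2"] q by (simp add: norm_power power_less_one_iff)
qed

section \<open>Antiperiodic functions on a strip\<close>

text \<open>By \<open>lim\<close> every singularity is removable, and the antiperiods carry every
  value of the modulus back to a compact rectangle inside \<open>W\<close>, where it attains its
  maximum. So the maximum modulus principle applies, and the resulting constant is its own negative.
  A strip takes the place of the plane because the Lambert series of the continuation converge only
  there.\<close>

lemma antiperiodic_eq_0: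
  fixes f :: "complex \<Rightarrow> complex" and \<tau> :: complex
  defines "W \<equiv> {z. \<bar>Im z\<bar> < 3 / 2 * Im \<tau>}"
  assumes \<tau>: "Im \<tau> > 0"
    and mero: "f meromorphic_on W"
    and lim: "\<And>z. z \<in> W \<Longrightarrow> (\<lambda>w. (w - z) * f w) \<midarrow>z\<rightarrow> 0"
    and per1: "\<And>z. z \<in> W \<Longrightarrow> f (z + 1) = - f z"
    and per\<tau>: "\<And>z. z \<in> W \<Longrightarrow> z + \<tau> \<in> W \<Longrightarrow> f (z + \<tau>) = - f z"
    and z: "z \<in> W" "isCont f z"
  shows "f z = 0"
proof -
  define g where "g = remove_sings f"
  have oW: "open W"
    unfolding W_def by (intro open_Collect_less continuous_intros)
  have "W = {z. Im z < 3 / 2 * Im \<tau>} \<inter> {z. Im z > - (3 / 2 * Im \<tau>)}"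
    by (auto simp: W_def)
  then have "convex W"
    by (simp only:) (intro convex_Int convex_halfspace_Im_lt convex_halfspace_Im_gt)
  then have conW: "connected W" by (rule convex_connected)
  have *: "g analytic_on {z} \<and> f \<midarrow>z\<rightarrow> g z" if "z \<in> W" for z
  proof -
    have iso: "isolated_singularity_at f z"
      using mero that meromorphic_on_isolated_singularity meromorphic_on_subset by blast
    then obtain \<rho> where \<rho>: "\<rho> > 0" "f analytic_on ball z \<rho> - {z}"
      by (auto simp: isolated_singularity_at_def)
    have "\<exists>h. h holomorphic_on ball z \<rho> \<and> (\<forall>w\<in>ball z \<rho> - {z}. h w = f w)"
      using lim[OF that] \<rho>
      by (subst holomorphic_on_extend_lim) (auto intro: analytic_imp_holomorphic)
    then obtain h where h: "h holomorphic_on ball z \<rho>" "\<And>w. w \<in> ball z \<rho> - {z} \<Longrightarrow> h w = f w"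
      by blast
    have "isCont h z"
      using holomorphic_on_imp_continuous_on[OF h(1)] \<rho>(1) continuous_on_interior
      by (simp add: continuous_on_eq_continuous_at)
    then have "h \<midarrow>z\<rightarrow> h z" by (simp add: isCont_def)
    moreover have "eventually (\<lambda>w. h w = f w) (at z)"
      using eventually_at_in_open[of "ball z \<rho>" z] \<rho>(1)
      by (auto elim!: eventually_mono simp: h)
    ultimately have fl: "f \<midarrow>z\<rightarrow> h z"
      by (rule Lim_transform_eventually)
    then show ?thesis
      using remove_sings_analytic_at[OF iso fl] remove_sings_eqI[OF fl] by (simp add: g_def)
  qed
  have "g analytic_on W"
    using * analytic_on_analytic_at by blast
  then have hol: "g holomorphic_on W" by (rule analytic_imp_holomorphic)
  \<comment> \<open>At a singularity the value of \<open>f\<close> need not be its limit, so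
    antiperiodicity passes to \<open>g\<close> through the limits at \<open>z\<close> and
    \<open>z + a\<close>; openness of \<open>W\<close> supplies the neighbourhood.\<close>
  have shift: "g (z + a) = - g z"
    if a: "\<And>w. w \<in> W \<Longrightarrow> w + a \<in> W \<Longrightarrow> f (w + a) = - f w" and z: "z \<in> W" "z + a \<in> W" for a z
  proof -
    have "(\<lambda>w. f (w + a)) \<midarrow>z\<rightarrow> g (z + a)"
      using conjunct2[OF *[OF z(2)]] by (subst (asm) LIM_offset_zero_iff, simp, subst LIM_offset_zero_iff) (simp_all add: add_ac)
    moreover have "eventually (\<lambda>w. f (w + a) = - f w) (at z)"
    proof -
      have "eventually (\<lambda>w. w \<in> W \<inter> ((\<lambda>w. w + a) -` W)) (at z)"
        using z oW by (intro eventually_at_in_open' open_Int open_vimage) (auto intro!: continuous_intros)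
      then show ?thesis by eventually_elim (auto intro: a)
    qed
    ultimately have "(\<lambda>w. - f w) \<midarrow>z\<rightarrow> g (z + a)"
      by (rule Lim_transform_eventually)
    moreover have "(\<lambda>w. - f w) \<midarrow>z\<rightarrow> - g z"
      using * z by (intro tendsto_minus) auto
    ultimately show ?thesis by (intro tendsto_unique) auto
  qed
  have W1: "z + 1 \<in> W \<longleftrightarrow> z \<in> W" for z by (simp add: W_def)
  have g1: "g (z + 1) = - g z" if "z \<in> W" for z
    by (rule shift) (use that per1 W1 in auto)
  have gn: "norm (g (z + of_nat n)) = norm (g z)" if "z \<in> W" for z n
  proof (induction n)
    case (Suc n)
    have "z + of_nat n \<in> W" using that by (simp add: W_def)
    from g1[OF this] Suc show ?case by (simp add: add_ac)
  qed auto
  have gi: "norm (g (z + of_int n)) = norm (g z)" if "z \<in> W" for z n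
  proof (cases "n \<ge> 0")
    case True
    then show ?thesis using gn[OF that, of "nat n"] by simp
  next
    case False
    have "z + of_int n \<in> W" using that by (simp add: W_def)
    from gn[OF this, of "nat (- n)"] False show ?thesis by simp
  qed
  \<comment> \<open>An integer translation brings the real part into [0, 1), so \<open>K\<close>
    meets the orbit of every point with \<open>\<bar>Im w\<bar> \<le> Im \<tau> / 2\<close>.\<close>
  define K where "K = cbox (Complex (-1) (- Im \<tau> / 2)) (Complex 1 (Im \<tau> / 2))"
  have K: "w \<in> K \<longleftrightarrow> \<bar>Re w\<bar> \<le> 1 \<and> \<bar>Im w\<bar> \<le> Im \<tau> / 2" for w
    by (auto simp: K_def in_cbox_complex_iff)
  have KW: "K \<subseteq> W"
    using \<tau> by (auto simp: K W_def)
  have "0 \<in> K" using \<tau> by (simp add: K)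
  then have "\<exists>\<xi>\<in>K. \<forall>w\<in>K. norm (g w) \<le> norm (g \<xi>)"
    by (intro continuous_attains_sup continuous_on_norm
         holomorphic_on_imp_continuous_on[OF holomorphic_on_subset[OF hol KW]])
       (auto simp: K_def)
  then obtain \<xi> where \<xi>: "\<xi> \<in> K" "\<And>w. w \<in> K \<Longrightarrow> norm (g w) \<le> norm (g \<xi>)" by blast
  have bd0: "norm (g w) \<le> norm (g \<xi>)" if "\<bar>Im w\<bar> \<le> Im \<tau> / 2" for w
  proof -
    have w: "w \<in> W" using that \<tau> by (simp add: W_def)
    have "w + of_int (- \<lfloor>Re w\<rfloor>) \<in> K"
      using that by (simp add: K) linarith
    from \<xi>(2)[OF this] gi[OF w, of "- \<lfloor>Re w\<rfloor>"] show ?thesis by simp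
  qed
  \<comment> \<open>The height 3/2 is the reach of a single shift: subtracting or adding \<tau>
    takes the outer parts of \<open>W\<close> into the middle strip.\<close>
  have bd: "norm (g w) \<le> norm (g \<xi>)" if w: "w \<in> W" for w
  proof -
    consider "\<bar>Im w\<bar> \<le> Im \<tau> / 2" | "Im w > Im \<tau> / 2" | "Im w < - Im \<tau> / 2" by linarith
    then show ?thesis
    proof cases
      case 2
      have "w - \<tau> \<in> W" "\<bar>Im (w - \<tau>)\<bar> \<le> Im \<tau> / 2" using 2 w \<tau> unfolding W_def mem_Collect_eq minus_complex.sel plus_complex.sel by linarith+
      with shift[OF per\<tau>, of "w - \<tau>"] bd0[of "w - \<tau>"] w show ?thesis by simp
    next
      case 3
      have "w + \<tau> \<in> W" "\<bar>Im (w + \<tau>)\<bar> \<le> Im \<tau> / 2" using 3 w \<tau> unfolding W_def mem_Collect_eq minus_complex.sel plus_complex.sel by linarith+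
      with shift[OF per\<tau>, of w] bd0[of "w + \<tau>"] w show ?thesis by simp
    qed (rule bd0)
  qed
  have "g constant_on W"
    using \<xi>(1) KW by (intro maximum_modulus_principle[OF hol oW conW oW order_refl _ bd]) auto
  then obtain c where c: "\<And>w. w \<in> W \<Longrightarrow> g w = c" by (auto simp: constant_on_def)
  have "c = - c" using g1[OF z(1)] c W1 z(1) by metis
  then have "g z = 0" using c z(1) by simp
  moreover have "g z = f z"
    unfolding g_def using z(2) by (intro remove_sings_eqI) (simp add: isCont_def)
  ultimately show ?thesis by simp
qed

section \<open>The product\<close>

definition ue :: "complex \<Rightarrow> complex" where
  "ue z = exp (\<i> * of_real pi * z)"

lemma ue_nonzero [simp]: "ue z \<noteq> 0"
  by (simp add: ue_def)

lemma ue_add: "ue (a + b) = ue a * ue b"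
  by (simp add: ue_def ring_distribs exp_add)

lemma ue_minus: "ue (- a) = inverse (ue a)"
  by (simp add: ue_def exp_minus)

lemma ue_of_nat_mult: "ue (of_nat n * a) = ue a ^ n"
  by (simp add: ue_def exp_of_nat_mult[symmetric] mult_ac)

lemma ue_power2: "(ue a)\<^sup>2 = ue (2 * a)"
  using ue_of_nat_mult[of 2 a] by simp

lemma ue_1 [simp]: "ue 1 = -1"
  by (simp add: ue_def)

lemma ue_half: "ue (1 / 2) = \<i>"
  using exp_pi_i' by (simp add: ue_def exp_eq_polar cis_conv_exp[symmetric] mult.commute)

lemma norm_ue: "norm (ue z) = exp (- pi * Im z)"
  by (simp add: ue_def)

lemma norm_ue_less_1: "norm (ue z) < 1 \<longleftrightarrow> Im z > 0"
  by (simp add: norm_ue zero_less_mult_iff)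

lemma ue_eq_1D:
  assumes "ue z = 1"
  obtains k :: int where "z = 2 * of_int k"
proof -
  from assms obtain k :: int where k: "Re (\<i> * of_real pi * z) = 0" "Im (\<i> * of_real pi * z) = of_int (2 * k) * pi"
    unfolding ue_def exp_eq_1 by blast
  then have "z = 2 * of_int k"
    by (simp add: complex_eq_iff)
  then show ?thesis by (rule that)
qed

lemma analytic_ue [analytic_intros]: "f analytic_on A \<Longrightarrow> (\<lambda>z. ue (f z)) analytic_on A"
  unfolding ue_def by (intro analytic_intros)

lemma ue_has_field_derivative [derivative_intros]:
  "(f has_field_derivative f') (at z within A) \<Longrightarrow>
    ((\<lambda>z. ue (f z)) has_field_derivative (\<i> * of_real pi * f' * ue (f z))) (at z within A)"
  unfolding ue_def by (auto intro!: derivative_eq_intros)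

lemma sin_conv_ue: "sin (of_real pi * z) = (ue z - inverse (ue z)) / (2 * \<i>)"
  by (simp add: sin_exp_eq ue_def exp_minus mult_ac)

lemma cos_conv_ue: "cos (of_real pi * z) = (ue z + inverse (ue z)) / 2"
  by (simp add: cos_exp_eq ue_def exp_minus mult_ac)

text \<open>This is the inverse of the difference quotient at a simple zero; the residues of the
  product and of the polar part are read off from it.\<close>

lemma tendsto_divide_simple_zero:
  fixes h :: "complex \<Rightarrow> complex"
  assumes "(h has_field_derivative d) (at a)" "h a = 0" "d \<noteq> 0"
  shows "(\<lambda>z. (z - a) / h z) \<midarrow>a\<rightarrow> 1 / d"
proof -
  have "(\<lambda>z. inverse (h z / (z - a))) \<midarrow>a\<rightarrow> inverse d"
    using assms by (intro tendsto_inverse) (auto simp: has_field_derivative_iff)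
  then show ?thesis by (simp add: inverse_eq_divide)
qed

lemma is_pole_if_residue_limit:
  fixes f :: "complex \<Rightarrow> complex"
  assumes "(\<lambda>z. (z - a) * f z) \<midarrow>a\<rightarrow> c" "c \<noteq> 0"
  shows "is_pole f a"
proof -
  have "filterlim (\<lambda>z. z - a) (at 0) (at a)"
    by (intro filterlim_atI tendsto_eq_intros) (auto simp: eventually_at_filter)
  then have "filterlim (\<lambda>z. ((z - a) * f z) / (z - a)) at_infinity (at a)"
    by (rule filterlim_divide_at_infinity[OF assms(1) _ assms(2)])
  moreover have "eventually (\<lambda>z. ((z - a) * f z) / (z - a) = f z) (at a)"
    by (simp add: eventually_at_filter)
  ultimately show ?thesis
    unfolding is_pole_def by (rule filterlim_cong[THEN iffD1, OF refl refl, rotated])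
qed

section \<open>Antiperiods, poles and residues of the product\<close>

definition sd_const :: "complex \<Rightarrow> complex" where
  "sd_const r = (qpoch (r ^ 4) (r ^ 4))\<^sup>2 * (qpoch (r\<^sup>2) r)\<^sup>2"

text \<open>The right-hand side of the theorem. With r = exp (i pi \<tau>) one has q = r^2 and
  q^(1/4) = \<open>ue (\<tau> / 2)\<close>, and the infinite products become q-Pochhammer symbols
  with base r^2 or r^4.\<close>

definition sd_prod :: "complex \<Rightarrow> complex \<Rightarrow> complex" where
  "sd_prod \<tau> z = (let r = ue \<tau>; w = ue z in
     (w - inverse w) / (2 * \<i>) * ue (\<tau> / 2) * sd_const r *
     ((qpoch (r\<^sup>2) (r\<^sup>2 * w\<^sup>2) * qpoch (r\<^sup>2) (r\<^sup>2 * inverse w ^ 2)) /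
      (qpoch (r\<^sup>2) (- r * w\<^sup>2) * qpoch (r\<^sup>2) (- r * inverse w ^ 2))))"

text \<open>The zeros of the denominators: those with \<open>n \<ge> 0\<close> come from the factors
  in exp (- 2 i pi z), those with \<open>n < 0\<close> from the factors in exp (2 i pi z). The
  indices count translations away from 1/2 + \<tau>/2.\<close>

definition sd_pole :: "complex \<Rightarrow> int \<Rightarrow> int \<Rightarrow> complex" where
  "sd_pole \<tau> m n = 1 / 2 + \<tau> / 2 + of_int m + of_int n * \<tau>"

context
  fixes \<tau> :: complex
  assumes \<tau>: "Im \<tau> > 0"
begin

lemma norm_nome: "norm (ue \<tau>) < 1" "norm ((ue \<tau>)\<^sup>2) < 1" "norm (ue \<tau> ^ 4) < 1"
  using \<tau> norm_ue_less_1[of \<tau>] by (simp_all add: norm_power power_less_one_iff)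

text \<open>The constant is chosen for this identity, which makes the residues independent of \<open>\<tau>\<close>.\<close>
lemma sd_const_mult: "sd_const (ue \<tau>) * (qpoch ((ue \<tau>)\<^sup>2) (- ue \<tau>))\<^sup>2 = (qpoch ((ue \<tau>)\<^sup>2) ((ue \<tau>)\<^sup>2))\<^sup>2"
proof -
  define r where "r = ue \<tau>"
  have r4: "(r\<^sup>2)\<^sup>2 = r ^ 4" "r\<^sup>2 * r\<^sup>2 = r ^ 4" by (simp_all add: power_add[symmetric] flip: power_mult)
  have "qpoch (r\<^sup>2) r * qpoch (r\<^sup>2) (- r) = qpoch (r ^ 4) (r\<^sup>2)"
    using qpoch_mult_uminus[of "r\<^sup>2" r] norm_nome r4 by (simp add: r_def)
  moreover have "qpoch (r ^ 4) (r\<^sup>2) * qpoch (r ^ 4) (r ^ 4) = qpoch (r\<^sup>2) (r\<^sup>2)"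
    using qpoch_square[of "r\<^sup>2" "r\<^sup>2"] norm_nome r4 by (simp add: r_def)
  ultimately have "qpoch (r\<^sup>2) (r\<^sup>2) = qpoch (r\<^sup>2) r * qpoch (r\<^sup>2) (- r) * qpoch (r ^ 4) (r ^ 4)"
    by simp
  then show ?thesis by (simp add: sd_const_def r_def[symmetric] power_mult_distrib)
qed

lemma sd_prod_add_1: "sd_prod \<tau> (z + 1) = - sd_prod \<tau> z"
proof -
  have "(- w - inverse (- w)) / (2 * \<i>) * A * B * C = - ((w - inverse w) / (2 * \<i>) * A * B * C)"
    for w A B C :: complex
    by (simp add: algebra_simps add_divide_distrib diff_divide_distrib)
  moreover have "ue (z + 1) = - ue z" by (simp add: ue_add)
  ultimately show ?thesis by (simp only: sd_prod_def Let_def) simp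
qed

text \<open>Replacing w by r w multiplies the argument of each symbol by r^2 or r^(-2), so
  \<open>qpoch_rec\<close> adds or removes one factor. These four factors and the change of the sine
  combine to -1.\<close>

lemma sd_prod_add_\<tau>: "sd_prod \<tau> (z + \<tau>) = - sd_prod \<tau> z"
proof -
  define r w where "r = ue \<tau>" and "w = ue z"
  define Q where "Q = qpoch (r\<^sup>2)"
  have [simp]: "r \<noteq> 0" "w \<noteq> 0" by (simp_all add: r_def w_def)
  note rec = qpoch_rec[OF norm_nome(2), folded r_def, folded Q_def]
  define a b c d where "a = Q (r ^ 4 * w\<^sup>2)" and "b = Q (r\<^sup>2 * inverse w ^ 2)"
    and "c = Q (- (r ^ 3) * w\<^sup>2)" and "d = Q (- r * inverse w ^ 2)"
  have 1: "Q (r\<^sup>2 * w\<^sup>2) = (1 - r\<^sup>2 * w\<^sup>2) * a" "Q (r\<^sup>2 * (r * w)\<^sup>2) = a"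
    using rec[of "r\<^sup>2 * w\<^sup>2"] by (simp_all add: a_def power_mult_distrib power2_eq_square power4_eq_xxxx mult_ac)
  have 2: "Q (r\<^sup>2 * inverse (r * w) ^ 2) = (1 - inverse w ^ 2) * b"
    using rec[of "inverse w ^ 2"] by (simp add: b_def power_mult_distrib field_simps)
  have 3: "Q (- r * w\<^sup>2) = (1 + r * w\<^sup>2) * c" "Q (- r * (r * w)\<^sup>2) = c"
    using rec[of "- r * w\<^sup>2"] by (simp_all add: c_def power_mult_distrib power2_eq_square power3_eq_cube mult_ac)
  have 4: "Q (- r * inverse (r * w) ^ 2) = (1 + 1 / (r * w\<^sup>2)) * d"
    using rec[of "- r * inverse (r * w) ^ 2"] by (simp add: d_def power_mult_distrib power2_eq_square field_simps)
  have wr: "ue (z + \<tau>) = r * w" by (simp add: ue_add r_def w_def mult.commute)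
  have "(r * w - inverse (r * w)) * (a * ((1 - inverse w ^ 2) * b) / (c * ((1 + 1 / (r * w\<^sup>2)) * d))) =
     - ((w - inverse w) * (((1 - r\<^sup>2 * w\<^sup>2) * a * b) / ((1 + r * w\<^sup>2) * c * d)))"
  \<comment> \<open>At a pole both sides are 0 because x / 0 = 0: \<open>1 + r * w\<^sup>2\<close>
    and \<open>1 + 1 / (r * w\<^sup>2)\<close> vanish together, and \<open>c\<close>,
    \<open>d\<close> occur on both sides.\<close>
  proof (cases "1 + r * w\<^sup>2 = 0 \<or> c = 0 \<or> d = 0")
    case True
    then show ?thesis
    proof (elim disjE)
      assume *: "1 + r * w\<^sup>2 = 0"
      then have "1 + 1 / (r * w\<^sup>2) = 0" by (simp add: field_simps)
      with * show ?thesis by (simp only:) simp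
    qed auto
  next
    case False
    have e: "1 + 1 / (r * w\<^sup>2) = (1 + r * w\<^sup>2) / (r * w\<^sup>2)" by (simp add: field_simps)
    define y where "y = 1 + r * w\<^sup>2"
    have "y \<noteq> 0" "c \<noteq> 0" "d \<noteq> 0" using False by (auto simp: y_def)
    then show ?thesis unfolding e unfolding y_def[symmetric] 
      by (simp add: divide_simps) (simp add: algebra_simps power2_eq_square)
  qed
  then have "X * (r * w - inverse (r * w)) * (a * ((1 - inverse w ^ 2) * b) / (c * ((1 + 1 / (r * w\<^sup>2)) * d))) =
     - (X * (w - inverse w) * (((1 - r\<^sup>2 * w\<^sup>2) * a * b) / ((1 + r * w\<^sup>2) * c * d)))" for X
    by (simp only: mult.assoc mult_minus_right)
  from this[of "ue (\<tau> / 2) * sd_const r / (2 * \<i>)"] show ?thesis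
    unfolding sd_prod_def Let_def wr r_def[symmetric] w_def[symmetric] Q_def[symmetric] 1 2 3 4
      b_def[symmetric] d_def[symmetric]
    by (simp add: mult_ac)
qed

lemma sd_prod_shift_nat: "sd_prod \<tau> (z + of_nat m + of_nat n * \<tau>) = (-1) ^ (m + n) * sd_prod \<tau> z"
proof (induction n)
  case 0
  show ?case
  proof (induction m)
    case (Suc m)
    then show ?case using sd_prod_add_1[of "z + of_nat m"] by (simp add: add_ac)
  qed auto
next
  case (Suc n)
  then show ?case using sd_prod_add_\<tau>[of "z + of_nat m + of_nat n * \<tau>"] by (simp add: algebra_simps)
qed


lemma sd_prod_shift: "sd_prod \<tau> (z + of_int m + of_int n * \<tau>) = (-1) powi (m + n) * sd_prod \<tau> z"
proof -
  define M N where "M = nat \<bar>m\<bar>" and "N = nat \<bar>n\<bar>"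
  \<comment> \<open>A base point from which both \<open>z\<close> and the shifted point are reached
    by natural numbers of steps, so that negative \<open>m\<close> and \<open>n\<close> are covered
    by \<open>sd_prod_shift_nat\<close>.\<close>
  define z' where "z' = z - of_nat M - of_nat N * \<tau>"
  have M: "m + int M = int (nat (m + int M))" "n + int N = int (nat (n + int N))"
    by (auto simp: M_def N_def)
  have "sd_prod \<tau> z = (-1) ^ (M + N) * sd_prod \<tau> z'"
    using sd_prod_shift_nat[of z' M N] by (simp add: z'_def)
  moreover have "sd_prod \<tau> (z + of_int m + of_int n * \<tau>) =
      (-1) ^ (nat (m + int M) + nat (n + int N)) * sd_prod \<tau> z'"
  proof -
    have "z + of_int m + of_int n * \<tau> = z' + of_nat (nat (m + int M)) + of_nat (nat (n + int N)) * \<tau>"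
    proof -
      have "(of_nat (nat (m + int M)) :: complex) = of_int m + of_nat M"
        by (metis M(1) of_int_add of_int_of_nat_eq)
      moreover have "(of_nat (nat (n + int N)) :: complex) = of_int n + of_nat N"
        by (metis M(2) of_int_add of_int_of_nat_eq)
      ultimately show ?thesis by (simp add: z'_def algebra_simps)
    qed
    then show ?thesis using sd_prod_shift_nat by simp
  qed
  moreover have "(-1 :: complex) ^ (nat (m + int M) + nat (n + int N)) = (-1) powi (m + n) * (-1) ^ (M + N)"
  proof -
    have "(-1 :: complex) ^ (nat (m + int M) + nat (n + int N)) = (-1) powi (int (nat (m + int M)) + int (nat (n + int N)))"
      by (metis of_nat_add power_int_of_nat)
    also have "\<dots> = (-1) powi (m + n + int (M + N))"
      by (simp only: M[symmetric]) (simp add: add_ac)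
    also have "\<dots> = (-1) powi (m + n) * (-1) powi (int (M + N))"
      by (rule power_int_add) simp
    finally show ?thesis by (simp only: power_int_of_nat)
  qed
  ultimately show ?thesis by (simp only: mult.assoc)
qed

lemma ue_half_double: "(ue (\<tau> / 2))\<^sup>2 = ue \<tau>"
  by (simp add: ue_power2)

text \<open>The minus sign is absorbed by \<open>ue 1 = -1\<close>, so the vanishing of a
  denominator reads \<open>ue (...) = 1\<close>, and \<open>ue_eq_1D\<close> solves this for
  \<open>z\<close>.\<close>

lemma sd_prod_analytic:
  assumes "\<And>m n. z \<noteq> sd_pole \<tau> m n"
  shows "sd_prod \<tau> analytic_on {z}"
proof -
  have 1: "qpoch ((ue \<tau>)\<^sup>2) (- ue \<tau> * (ue z)\<^sup>2) \<noteq> 0"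
  proof
    assume "qpoch ((ue \<tau>)\<^sup>2) (- ue \<tau> * (ue z)\<^sup>2) = 0"
    then obtain n where "- ue \<tau> * (ue z)\<^sup>2 * ((ue \<tau>)\<^sup>2) ^ n = 1"
      using qpoch_eq_0_iff[OF norm_nome(2)] by blast
    then have "ue (1 + \<tau> + 2 * z + of_nat n * (2 * \<tau>)) = 1"
      unfolding ue_add ue_of_nat_mult ue_power2[symmetric] by simp
    then obtain k :: int where "1 + \<tau> + 2 * z + of_nat n * (2 * \<tau>) = 2 * of_int k"
      by (rule ue_eq_1D)
    then have "z = sd_pole \<tau> (k - 1) (- int n - 1)"
      unfolding sd_pole_def by (simp add: field_simps)
    with assms show False by blast
  qed
  have 2: "qpoch ((ue \<tau>)\<^sup>2) (- ue \<tau> * inverse (ue z) ^ 2) \<noteq> 0"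
  proof
    assume "qpoch ((ue \<tau>)\<^sup>2) (- ue \<tau> * inverse (ue z) ^ 2) = 0"
    then obtain n where "- ue \<tau> * inverse (ue z) ^ 2 * ((ue \<tau>)\<^sup>2) ^ n = 1"
      using qpoch_eq_0_iff[OF norm_nome(2)] by blast
    then have "ue (1 + \<tau> + 2 * (- z) + of_nat n * (2 * \<tau>)) = 1"
      unfolding ue_add ue_of_nat_mult ue_power2[symmetric] ue_minus by simp
    then obtain k :: int where "1 + \<tau> + 2 * (- z) + of_nat n * (2 * \<tau>) = 2 * of_int k"
      by (rule ue_eq_1D)
    then have "2 * z = 2 * sd_pole \<tau> (- k) (int n)"
      unfolding sd_pole_def by (simp add: algebra_simps)
    then have "z = sd_pole \<tau> (- k) (int n)" by simp
    with assms show False by blast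
  qed
  show ?thesis
    unfolding sd_prod_def Let_def
    using 1 2 norm_nome by (intro analytic_intros) auto
qed

lemma isCont_qpoch: "isCont f z \<Longrightarrow> isCont (\<lambda>z. qpoch ((ue \<tau>)\<^sup>2) (f z)) z" for f :: "complex \<Rightarrow> complex"
  using isCont_o2[of z f "qpoch ((ue \<tau>)\<^sup>2)"]
    holomorphic_on_imp_continuous_on[OF holomorphic_qpoch[OF norm_nome(2)]]
  by (simp add: continuous_on_eq_continuous_at)

lemma isCont_ue: "isCont f z \<Longrightarrow> isCont (\<lambda>z. ue (f z)) z" for f :: "complex \<Rightarrow> complex"
  unfolding ue_def by (intro continuous_intros)

lemma sd_prod_residue_0: "(\<lambda>z. (z - sd_pole \<tau> 0 0) * sd_prod \<tau> z) \<midarrow>sd_pole \<tau> 0 0\<rightarrow> 1 / (4 * pi * \<i>)"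
proof -
  define r s p where "r = ue \<tau>" and "s = ue (\<tau> / 2)" and "p = sd_pole \<tau> 0 0"
  define Q where "Q = qpoch (r\<^sup>2)"
  have [simp]: "r \<noteq> 0" "s \<noteq> 0" by (simp_all add: r_def s_def)
  have sr: "s\<^sup>2 = r" by (simp add: r_def s_def ue_half_double)
  note rec = qpoch_rec[OF norm_nome(2), folded r_def, folded Q_def]
  have up: "ue p = \<i> * s" by (simp add: p_def sd_pole_def ue_add ue_half s_def)
  then have up2: "(ue p)\<^sup>2 = - r" by (simp add: power_mult_distrib sr)
  have up3: "inverse (ue p) ^ 2 = - inverse r" using up2 by (simp add: power_inverse)
  have b: "r\<^sup>2 * (ue p)\<^sup>2 = - (r ^ 3)" "r\<^sup>2 * inverse (ue p) ^ 2 = - r" "- r * (ue p)\<^sup>2 = r\<^sup>2"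
    "- (r ^ 3) * inverse (ue p) ^ 2 = r\<^sup>2"
    unfolding up2 up3 by (simp_all add: power2_eq_square power3_eq_cube)
  \<comment> \<open>Among the denominator factors only the one with n = 0 in exp (- 2 i pi z)
    vanishes at \<open>p\<close>. It is split off as \<open>h\<close> by \<open>qpoch_rec\<close>,
    and the remainder \<open>R\<close> is continuous at \<open>p\<close>.\<close>
  define h where "h = (\<lambda>z. 1 + r * inverse (ue z) ^ 2)"
  define R where "R = (\<lambda>z. (ue z - inverse (ue z)) / (2 * \<i>) * s * sd_const r *
     (Q (r\<^sup>2 * (ue z)\<^sup>2) * Q (r\<^sup>2 * inverse (ue z) ^ 2) / (Q (- r * (ue z)\<^sup>2) * Q (- (r ^ 3) * inverse (ue z) ^ 2))))"
  have eq: "sd_prod \<tau> z = R z / h z" for z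
    using rec[of "- r * inverse (ue z) ^ 2"]
    by (simp add: sd_prod_def R_def h_def Let_def Q_def r_def s_def power2_eq_square power3_eq_cube mult_ac)
  have hp: "h p = 0" using up2 by (simp add: h_def power_inverse)
  have "(h has_field_derivative (2 * \<i> * pi)) (at p)"
  proof -
    have "h = (\<lambda>z. 1 + r * ue (- 2 * z))"
      by (auto simp: h_def ue_minus ue_power2 power_inverse)
    moreover have "ue (- 2 * p) = - 1 / r"
      using up2 by (simp add: ue_minus ue_power2 inverse_eq_divide)
    ultimately show ?thesis
      by (auto intro!: derivative_eq_intros)
  qed
  then have 1: "(\<lambda>z. (z - p) / h z) \<midarrow>p\<rightarrow> 1 / (2 * \<i> * pi)"
    by (rule tendsto_divide_simple_zero) (use hp in simp_all)
  have nz: "Q (r\<^sup>2) \<noteq> 0"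
    unfolding Q_def r_def using norm_nome by (intro qpoch_nonzero)
  have "isCont R p"
  proof -
    have cQ: "isCont (\<lambda>z. Q (f z)) p" if "isCont f p" for f
      using isCont_qpoch[OF that] by (simp add: Q_def r_def)
    have cu: "isCont ue p" using isCont_ue[where f = "\<lambda>z. z"] by simp
    show ?thesis unfolding R_def
      using nz by (intro continuous_intros cQ cu) (simp_all only: b, simp_all)
  qed
  \<comment> \<open>The factor q^(1/4) turns the sine into (1 + r) / 2, and 1 + r completes Q(- r^3)
    to Q(- r). The rest is \<open>sd_const_mult\<close>, so r drops out.\<close>
  moreover have "R p = 1 / 2"
  proof -
    have a: "(ue p - inverse (ue p)) / (2 * \<i>) * s = (1 + r) / 2"
      unfolding up sr[symmetric] by (simp add: field_simps power2_eq_square)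
    have c: "(1 + r) * Q (- (r ^ 3)) = Q (- r)"
      using rec[of "- r"] by (simp add: power2_eq_square power3_eq_cube mult_ac)
    have "R p = (1 + r) / 2 * sd_const r * (Q (- (r ^ 3)) * Q (- r) / (Q (r\<^sup>2) * Q (r\<^sup>2)))"
      unfolding R_def b a ..
    also have "\<dots> = sd_const r * (((1 + r) * Q (- (r ^ 3))) * Q (- r)) / (2 * (Q (r\<^sup>2))\<^sup>2)"
      by (simp add: power2_eq_square field_simps)
    also have "\<dots> = 1 / 2"
      unfolding c using nz sd_const_mult[folded r_def, folded Q_def] by (simp add: power2_eq_square)
    finally show ?thesis .
  qed
  ultimately have 2: "R \<midarrow>p\<rightarrow> 1 / 2" by (simp add: isCont_def)
  show ?thesis
    using tendsto_mult[OF 1 2] by (simp add: eq p_def mult_ac)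
qed

lemma sd_prod_residue:
  "(\<lambda>z. (z - sd_pole \<tau> m n) * sd_prod \<tau> z) \<midarrow>sd_pole \<tau> m n\<rightarrow> (-1) powi (m + n) / (4 * pi * \<i>)"
proof -
  have p: "sd_pole \<tau> m n = sd_pole \<tau> 0 0 + of_int m + of_int n * \<tau>" by (simp add: sd_pole_def)
  have "(\<lambda>h. (-1) powi (m + n) * (h * sd_prod \<tau> (sd_pole \<tau> 0 0 + h))) \<midarrow>0\<rightarrow> (-1) powi (m + n) * (1 / (4 * pi * \<i>))"
    using sd_prod_residue_0 by (intro tendsto_mult tendsto_const) (simp add: LIM_offset_zero_iff)
  moreover have "(-1) powi (m + n) * (h * sd_prod \<tau> (sd_pole \<tau> 0 0 + h)) = h * sd_prod \<tau> (sd_pole \<tau> m n + h)" for h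
    using sd_prod_shift[of "sd_pole \<tau> 0 0 + h" m n] by (simp add: p add_ac)
  ultimately show ?thesis
    by (subst LIM_offset_zero_iff) auto
qed

text \<open>A denominator contains \<open>qpoch\<close> at argument 1, which is 0, and x / 0 = 0.
  This is the value that \<open>nicely_meromorphic_on\<close> prescribes at a pole.\<close>

lemma sd_prod_at_pole: "sd_prod \<tau> (sd_pole \<tau> m n) = 0"
proof -
  have "sd_prod \<tau> (sd_pole \<tau> 0 0) = 0"
  proof -
    have "(ue (sd_pole \<tau> 0 0))\<^sup>2 = - ue \<tau>"
      by (simp add: sd_pole_def ue_add ue_half power_mult_distrib ue_half_double)
    then show ?thesis
      using qpoch_rec[OF norm_nome(2), of 1] by (simp add: sd_prod_def Let_def power_inverse)
  qed
  then show ?thesis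
    using sd_prod_shift[of "sd_pole \<tau> 0 0" m n] by (simp add: sd_pole_def add_ac)
qed

lemma sd_prod_nicely_meromorphic: "sd_prod \<tau> nicely_meromorphic_on UNIV"
  unfolding nicely_meromorphic_on_def
proof (intro conjI ballI)
  show "sd_prod \<tau> meromorphic_on UNIV"
    unfolding sd_prod_def Let_def
    by (intro meromorphic_intros analytic_on_imp_meromorphic_on analytic_intros) (use norm_nome in auto)
  fix z
  show "is_pole (sd_prod \<tau>) z \<and> sd_prod \<tau> z = 0 \<or> sd_prod \<tau> \<midarrow>z\<rightarrow> sd_prod \<tau> z"
  proof (cases "\<exists>m n. z = sd_pole \<tau> m n")
    case True
    then obtain m n where z: "z = sd_pole \<tau> m n" by blast
    show ?thesis
      unfolding z using is_pole_if_residue_limit[OF sd_prod_residue] sd_prod_at_pole by auto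
  next
    case False
    then show ?thesis
      using analytic_at_imp_isCont[OF sd_prod_analytic] by (auto simp: isCont_def)
  qed
qed

end

section \<open>The series\<close>

text \<open>The coefficients come from the cosines: with V = exp (i pi (n + 1/2) \<tau>) one has 1 /
  cos ((n + 1/2) pi \<tau>) = 2 V / (1 + V^2), and V^2 = r^(2n+1).\<close>

definition lambert :: "complex \<Rightarrow> complex \<Rightarrow> complex" where
  "lambert r x = (\<Sum>n. x ^ n / (1 + r ^ (2 * n + 1)))"

lemma one_plus_power_nonzero:
  fixes r :: complex
  assumes "norm r < 1" "n > 0"
  shows "1 + r ^ n \<noteq> 0"
proof
  assume "1 + r ^ n = 0"
  then have "norm (r ^ n) = 1" by (metis add_eq_0_iff norm_minus_cancel norm_one)
  then show False using assms power_less_one_iff[of "norm r" n] by (simp add: norm_power)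
qed

lemma lambert_sums:
  assumes r: "norm r < 1" and x: "norm x < 1"
  shows "(\<lambda>n. x ^ n / (1 + r ^ (2 * n + 1))) sums lambert r x"
  unfolding lambert_def
proof (rule summable_sums, rule summable_comparison_test')
  show "summable (\<lambda>n. norm x ^ n / (1 - norm r))"
    using x by (intro summable_divide summable_geometric) auto
  fix n :: nat
  have "1 - norm r \<le> 1 - norm (r ^ (2 * n + 1))"
    using r power_le_one[of "norm r" "2 * n"] by (simp add: norm_mult norm_power mult_left_le)
  also have "\<dots> \<le> norm (1 + r ^ (2 * n + 1))"
    using norm_triangle_ineq2[of 1 "- (r ^ (2 * n + 1))"] by (simp only: norm_minus_cancel norm_one diff_minus_eq_add)
  finally have "1 - norm r \<le> norm (1 + r ^ (2 * n + 1))" .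
  then show "norm (x ^ n / (1 + r ^ (2 * n + 1))) \<le> norm x ^ n / (1 - norm r)"
    using r unfolding norm_divide norm_power by (intro divide_left_mono mult_pos_pos) auto
qed

lemma analytic_lambert:
  assumes r: "norm r < 1" and f: "f analytic_on A" and x: "\<And>z. z \<in> A \<Longrightarrow> norm (f z) < 1"
  shows "(\<lambda>z. lambert r (f z)) analytic_on A"
proof -
  have "lambert r holomorphic_on ball 0 1"
    by (rule power_series_holomorphic[where a = "\<lambda>n. 1 / (1 + r ^ (2 * n + 1))"])
       (use lambert_sums[OF r] in simp)
  then have "lambert r analytic_on ball 0 1" by (simp add: analytic_on_open)
  from analytic_on_compose_gen[OF f this] x show ?thesis by (simp add: o_def)
qed

text \<open>Passing to r^2 x and multiplying by r multiplies the n-th term by r^(2n+1). The sum of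
  the two terms then cancels the denominator and leaves the geometric series.\<close>

lemma lambert_rec:
  assumes r: "norm r < 1" and x: "norm x < 1"
  shows "lambert r x + r * lambert r (r\<^sup>2 * x) = 1 / (1 - x)"
proof (rule sums_unique2)
  have "norm (r\<^sup>2 * x) \<le> 1 * norm x"
    unfolding norm_mult using r by (intro mult_right_mono) (auto simp: norm_power power_le_one)
  then have x': "norm (r\<^sup>2 * x) < 1" using x by simp
  have "x ^ n / (1 + r ^ (2 * n + 1)) + r * ((r\<^sup>2 * x) ^ n / (1 + r ^ (2 * n + 1))) = x ^ n" for n
  proof -
    have "r * (r\<^sup>2 * x) ^ n = x ^ n * r ^ (2 * n + 1)"
      by (simp add: power_mult_distrib flip: power_mult)
    then have "x ^ n / (1 + r ^ (2 * n + 1)) + r * ((r\<^sup>2 * x) ^ n / (1 + r ^ (2 * n + 1))) =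
        (x ^ n * (1 + r ^ (2 * n + 1))) / (1 + r ^ (2 * n + 1))"
      by (simp only: times_divide_eq_right add_divide_distrib[symmetric] ring_distribs mult_1_right)
    also have "\<dots> = x ^ n"
      using one_plus_power_nonzero[OF r, of "2 * n + 1"] by simp
    finally show ?thesis .
  qed
  then show "(\<lambda>n. x ^ n) sums (lambert r x + r * lambert r (r\<^sup>2 * x))"
    using sums_add[OF lambert_sums[OF r x] sums_mult[OF lambert_sums[OF r x'], of r]] by simp
  show "(\<lambda>n. x ^ n) sums (1 / (1 - x))"
    using x by (rule geometric_sums)
qed

section \<open>Continuation of the first series to a wider strip\<close>

definition sd_polar :: "complex \<Rightarrow> complex \<Rightarrow> complex" where
  "sd_polar \<tau> z = ue (\<tau> / 2) / (2 * \<i>) * (ue z / (1 + ue \<tau> * (ue z)\<^sup>2))"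

text \<open>The functional equation at x = - r w^2 gives L x = 1 / (1 - x) - r L (r^2 x).
  \<open>sd_polar\<close> carries the first term, with its explicit poles, and
  \<open>sd_regular\<close> the second, which converges further out.\<close>

definition sd_regular :: "complex \<Rightarrow> complex \<Rightarrow> complex" where
  "sd_regular \<tau> z = ue (\<tau> / 2) / (2 * \<i>) * (ue z * (ue \<tau> * lambert (ue \<tau>) (- (ue \<tau> ^ 3) * (ue z)\<^sup>2)))"

definition sd_ext :: "complex \<Rightarrow> complex \<Rightarrow> complex" where
  "sd_ext \<tau> z = (sd_polar \<tau> z - sd_polar \<tau> (- z)) - (sd_regular \<tau> z - sd_regular \<tau> (- z))"

context
  fixes \<tau> :: complex and W :: "complex set"
  assumes \<tau>: "Im \<tau> > 0"
  defines "W \<equiv> {z. \<bar>Im z\<bar> < 3 / 2 * Im \<tau>}"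
begin

text \<open>In \<open>W\<close> only the rows \<open>n = -1\<close> and \<open>n = 0\<close> of
  poles occur; \<open>sd_polar \<tau> z\<close> accounts for the first and
  \<open>sd_polar \<tau> (- z)\<close> for the second.\<close>

lemma polar_zero_iff: "1 + ue \<tau> * (ue z)\<^sup>2 = 0 \<longleftrightarrow> (\<exists>m. z = sd_pole \<tau> m (-1))"
proof
  assume "1 + ue \<tau> * (ue z)\<^sup>2 = 0"
  then have "- ue \<tau> * (ue z)\<^sup>2 = 1" by (simp add: add_eq_0_iff)
  then have "ue (1 + \<tau> + 2 * z) = 1"
    unfolding ue_add ue_power2[symmetric] by simp
  then obtain k :: int where "1 + \<tau> + 2 * z = 2 * of_int k"
    by (rule ue_eq_1D)
  then have "z = sd_pole \<tau> (k - 1) (- 1)"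
    unfolding sd_pole_def by (simp add: field_simps)
  then show "\<exists>m. z = sd_pole \<tau> m (-1)" by blast
next
  assume "\<exists>m. z = sd_pole \<tau> m (-1)"
  then obtain m where "z = sd_pole \<tau> m (-1)" by blast
  then have z: "\<tau> + 2 * z = 1 + of_int m * 2" by (simp add: sd_pole_def field_simps)
  have "ue (of_int m * 2) = 1"
    by (simp add: ue_def exp_eq_1)
  then have "ue (\<tau> + 2 * z) = -1"
    unfolding z ue_add by simp
  then show "1 + ue \<tau> * (ue z)\<^sup>2 = 0" by (simp add: ue_add ue_power2)
qed

lemma sd_pole_uminus: "- sd_pole \<tau> m n = sd_pole \<tau> (- m - 1) (- n - 1)"
  by (simp add: sd_pole_def field_simps)

lemma polar_zero_iff': "1 + ue \<tau> * (ue (- z))\<^sup>2 = 0 \<longleftrightarrow> (\<exists>m. z = sd_pole \<tau> m 0)"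
  unfolding polar_zero_iff
proof
  assume "\<exists>m. - z = sd_pole \<tau> m (-1)"
  then obtain m where "- z = sd_pole \<tau> m (-1)" by blast
  then have "z = sd_pole \<tau> (- m - 1) 0" using sd_pole_uminus[of m "-1"] by (metis add.inverse_inverse diff_self minus_minus)
  then show "\<exists>m. z = sd_pole \<tau> m 0" by blast
qed (auto simp: sd_pole_uminus)

lemma sd_polar_analytic: "\<nexists>m. z = sd_pole \<tau> m (-1) \<Longrightarrow> sd_polar \<tau> analytic_on {z}"
  unfolding sd_polar_def polar_zero_iff[symmetric] by (intro analytic_intros) auto

lemma sd_polar_analytic': "\<nexists>m. z = sd_pole \<tau> m 0 \<Longrightarrow> (\<lambda>z. sd_polar \<tau> (- z)) analytic_on {z}"
  unfolding sd_polar_def polar_zero_iff'[symmetric] by (intro analytic_intros) auto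

text \<open>This fixes the height of \<open>W\<close>: |r^3 w^2| < 1 means Im z > - 3/2 Im \<tau>,
  and the same condition for - z gives the upper bound.\<close>

lemma norm_regular:
  assumes "z \<in> W"
  shows "norm (- (ue \<tau> ^ 3) * (ue z)\<^sup>2) < 1"
proof -
  have "ue \<tau> ^ 3 * (ue z)\<^sup>2 = ue (3 * \<tau> + 2 * z)"
    using ue_of_nat_mult[of 3 \<tau>] by (simp add: ue_add ue_power2)
  moreover have "norm (ue (3 * \<tau> + 2 * z)) < 1"
  proof -
    have "Im (3 * \<tau> + 2 * z) = 3 * Im \<tau> + 2 * Im z" by simp
    then show ?thesis using assms unfolding norm_ue_less_1 W_def mem_Collect_eq by linarith
  qed
  ultimately show ?thesis by simp
qed

lemma uminus_W: "- z \<in> W \<longleftrightarrow> z \<in> W"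
  by (simp add: W_def)

lemma sd_regular_analytic: "sd_regular \<tau> analytic_on W"
  unfolding sd_regular_def using norm_nome[OF \<tau>] norm_regular
  by (intro analytic_intros analytic_lambert) auto

lemma sd_regular_analytic': "(\<lambda>z. sd_regular \<tau> (- z)) analytic_on W"
  unfolding sd_regular_def using norm_nome[OF \<tau>] norm_regular uminus_W
  by (intro analytic_intros analytic_lambert) auto

text \<open>Since q^(1/4) exp (i pi p) = i (-1)^m at the pole \<open>p\<close>, the residue is free
  of \<tau>. It is the residue of \<open>sd_prod\<close> in row \<open>n = -1\<close>.\<close>

lemma sd_polar_residue:
  "(\<lambda>z. (z - sd_pole \<tau> m (-1)) * sd_polar \<tau> z) \<midarrow>sd_pole \<tau> m (-1)\<rightarrow> - ((-1) powi m / (4 * pi * \<i>))"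
proof -
  define r s p where "r = ue \<tau>" and "s = ue (\<tau> / 2)" and "p = sd_pole \<tau> m (-1)"
  have [simp]: "r \<noteq> 0" "s \<noteq> 0" by (simp_all add: r_def s_def)
  have z: "1 + r * (ue p)\<^sup>2 = 0" unfolding p_def r_def polar_zero_iff by blast
  define h where "h = (\<lambda>z. 1 + r * (ue z)\<^sup>2)"
  have "(h has_field_derivative (- (2 * \<i> * pi))) (at p)"
  proof -
    have "(h has_field_derivative (2 * \<i> * pi * (r * (ue p)\<^sup>2))) (at p)"
      unfolding h_def by (auto intro!: derivative_eq_intros simp: power2_eq_square algebra_simps)
    moreover have "r * (ue p)\<^sup>2 = -1" using z by (simp add: add_eq_0_iff)
    ultimately show ?thesis by simp
  qed
  then have 1: "(\<lambda>z. (z - p) / h z) \<midarrow>p\<rightarrow> 1 / (- (2 * \<i> * pi))"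
    by (rule tendsto_divide_simple_zero) (use z in \<open>auto simp: h_def\<close>)
  have 2: "(\<lambda>z. s / (2 * \<i>) * ue z) \<midarrow>p\<rightarrow> s / (2 * \<i>) * ue p"
    unfolding ue_def by (intro tendsto_intros)
  have "s * ue p = ue (\<tau> / 2 + p)" by (simp add: ue_add s_def)
  also have "\<tau> / 2 + p = 1 / 2 + of_int m" by (simp add: p_def sd_pole_def)
  also have "ue (1 / 2 + of_int m) = \<i> * (-1) powi m"
  proof -
    have "ue (of_int m * 1) = ue 1 powi m"
      unfolding ue_def exp_power_int by (simp add: mult_ac)
    then show ?thesis by (simp add: ue_add ue_half)
  qed
  finally have sp: "s * ue p = \<i> * (-1) powi m" .
  have "s / (2 * \<i>) * ue p * (1 / (- (2 * \<i> * pi))) = - ((-1) powi m / (4 * pi * \<i>))"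
    using sp by (simp add: field_simps)
  with tendsto_mult[OF 2 1] show ?thesis
    by (simp add: sd_polar_def p_def[symmetric] h_def r_def s_def mult_ac)
qed

text \<open>Reflection at 0 of the preceding limit. This term enters \<open>sd_ext\<close> with a
  minus sign, so its contribution matches \<open>sd_prod\<close> in row
  \<open>n = 0\<close>.\<close>

lemma sd_polar_residue':
  "(\<lambda>z. (z - sd_pole \<tau> m 0) * sd_polar \<tau> (- z)) \<midarrow>sd_pole \<tau> m 0\<rightarrow> - ((-1) powi m / (4 * pi * \<i>))"
proof -
  define p where "p = sd_pole \<tau> m 0"
  have p: "- p = sd_pole \<tau> (- m - 1) (-1)" using sd_pole_uminus[of m 0] by (simp add: p_def)
  have "filterlim uminus (at (- p)) (at p)"
    by (intro filterlim_atI tendsto_intros) (auto simp: eventually_at_filter)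
  from filterlim_compose[OF sd_polar_residue[of "- m - 1", folded p] this]
  have "(\<lambda>z. - ((- z - - p) * sd_polar \<tau> (- z))) \<midarrow>p\<rightarrow> - (- ((-1) powi (- m - 1) / (4 * pi * \<i>)))"
    by (rule tendsto_minus)
  moreover have "(-1 :: complex) powi (- m - 1) = - ((-1) powi m)"
    by (simp add: power_int_diff power_int_minus flip: power_int_inverse)
  ultimately show ?thesis by (simp add: p_def[symmetric] algebra_simps)
qed

lemma sd_ext_add_1: "sd_ext \<tau> (z + 1) = - sd_ext \<tau> z"
proof -
  have "ue (z + 1) = - ue z" "ue (- (z + 1)) = - ue (- z)"
    unfolding ue_minus by (simp_all add: ue_add)
  then show ?thesis by (simp add: sd_ext_def sd_polar_def sd_regular_def)
qed

text \<open>The equation also holds at the poles, where \<open>x / 0 = 0\<close> removes the polar term on both sides.\<close>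
lemma sd_ext_add_\<tau>:
  assumes z: "z \<in> W" "z + \<tau> \<in> W"
  shows "sd_ext \<tau> (z + \<tau>) = - sd_ext \<tau> z"
proof -
  define r s w where "r = ue \<tau>" and "s = ue (\<tau> / 2)" and "w = ue z"
  define L where "L = lambert r"
  have [simp]: "r \<noteq> 0" "w \<noteq> 0" by (simp_all add: r_def w_def)
  have r: "norm r < 1" using norm_nome[OF \<tau>] by (simp add: r_def)
  \<comment> \<open>Both assumptions on \<open>z\<close> are used: \<open>z + \<tau> \<in> W\<close>
    gives |r w^(-2)| < 1 for the first functional equation, \<open>z \<in> W\<close> gives |r^3 w^2|
    < 1 for the second.\<close>
  have "Im (\<tau> + 2 * (- z)) = Im \<tau> - 2 * Im z" "Im (z + \<tau>) = Im z + Im \<tau>" by simp_all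
  then have "norm (ue (\<tau> + 2 * (- z))) < 1"
    using z unfolding norm_ue_less_1 W_def mem_Collect_eq by linarith
  also have "ue (\<tau> + 2 * (- z)) = r * inverse w ^ 2"
    unfolding ue_add ue_power2[symmetric] by (simp add: ue_minus r_def w_def)
  finally have 1: "L (- r * inverse w ^ 2) + r * L (- (r ^ 3) * inverse w ^ 2) = 1 / (1 + r * inverse w ^ 2)"
    using lambert_rec[OF r, of "- r * inverse w ^ 2"]
    by (simp add: L_def power2_eq_square power3_eq_cube mult_ac)
  have 2: "L (- (r ^ 3) * w\<^sup>2) + r * L (- (r ^ 3) * (w * r)\<^sup>2) = 1 / (1 + r * (w * r)\<^sup>2)"
    using lambert_rec[OF r, of "- (r ^ 3) * w\<^sup>2"] norm_regular[OF z(1)]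
    by (simp add: L_def r_def w_def power2_eq_square power3_eq_cube mult_ac)
  have 3: "- (r ^ 3) * inverse (w * r) ^ 2 = - r * inverse w ^ 2"
    by (simp add: power2_eq_square power3_eq_cube field_simps)
  \<comment> \<open>The shift interchanges the two halves: the polar term in - z, taken at
    \<open>z + \<tau>\<close>, is the polar term in z at \<open>z\<close>. The remaining terms, in
    \<open>l1\<close> and \<open>l2\<close>, reappear with opposite signs.\<close>
  have 4: "inverse (w * r) / (1 + r * inverse (w * r) ^ 2) = w / (1 + r * w\<^sup>2)"
  proof -
    have "1 + r * inverse (w * r) ^ 2 = (1 + r * w\<^sup>2) / (r * w\<^sup>2)"
      by (simp add: power2_eq_square field_simps)
    then show ?thesis by (simp add: power2_eq_square field_simps)
  qed
  have ext: "sd_ext \<tau> x = s / (2 * \<i>) * ((ue x / (1 + r * (ue x)\<^sup>2) - ue x * (r * L (- (r ^ 3) * (ue x)\<^sup>2)))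
      - (inverse (ue x) / (1 + r * inverse (ue x) ^ 2) - inverse (ue x) * (r * L (- (r ^ 3) * inverse (ue x) ^ 2))))" for x
    unfolding sd_ext_def sd_polar_def sd_regular_def ue_minus r_def[symmetric] s_def[symmetric] L_def[symmetric]
    by (simp add: algebra_simps)
  define l1 l2 where "l1 = L (- r * inverse w ^ 2)" and "l2 = L (- (r ^ 3) * w\<^sup>2)"
  have wr: "ue (z + \<tau>) = w * r" by (simp add: ue_add r_def w_def)
  have gen: "x / D - x * (r * Y) = x * l" if "l + r * Y = 1 / D" for x D Y l :: complex
  proof -
    have "x / D = x * (l + r * Y)" by (simp only: that times_divide_eq_right mult_1_right)
    then show ?thesis by (simp add: algebra_simps)
  qed
  have A: "w * r / (1 + r * (w * r)\<^sup>2) - w * r * (r * L (- (r ^ 3) * (w * r)\<^sup>2)) = w * r * l2"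
    by (rule gen[OF 2[folded l2_def]])
  have B: "inverse w / (1 + r * inverse w ^ 2) - inverse w * (r * L (- (r ^ 3) * inverse w ^ 2)) = inverse w * l1"
    by (rule gen[OF 1[folded l1_def]])
  show ?thesis
    unfolding ext wr w_def[symmetric] A B 3 4 l1_def[symmetric] l2_def[symmetric]
    by (simp add: algebra_simps)
qed

text \<open>
  On the narrow strip the functional equation of \<^const>\<open>lambert\<close> turns \<open>sd_polar \<tau> - sd_regular \<tau>\<close> into
  a multiple of \<open>w L (- r w\<^sup>2)\<close>, the sum of the terms of the series with positive frequency.
\<close>
lemma sd_ext_series:
  assumes z: "\<bar>Im z\<bar> < Im \<tau> / 2"
  shows "SD_term1 \<tau> z sums (2 * sd_ext \<tau> z)"
proof -
  define r s w where "r = ue \<tau>" and "s = ue (\<tau> / 2)" and "w = ue z"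
  have [simp]: "r \<noteq> 0" "w \<noteq> 0" "s \<noteq> 0" by (simp_all add: r_def w_def s_def)
  have sr: "s\<^sup>2 = r" using ue_half_double[OF \<tau>] by (simp add: r_def s_def)
  have r: "norm r < 1" using norm_nome[OF \<tau>] by (simp add: r_def)
  have *: "norm (- r * (ue x)\<^sup>2) < 1" if "\<bar>Im x\<bar> < Im \<tau> / 2" for x
  proof -
    have "Im (\<tau> + 2 * x) = Im \<tau> + 2 * Im x" by simp
    then have "norm (ue (\<tau> + 2 * x)) < 1"
      using that unfolding norm_ue_less_1 by linarith
    then show ?thesis unfolding ue_add ue_power2[symmetric] by (simp add: r_def)
  qed
  have half: "sd_polar \<tau> x - sd_regular \<tau> x = s / (2 * \<i>) * (ue x * lambert r (- r * (ue x)\<^sup>2))"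
    if "\<bar>Im x\<bar> < Im \<tau> / 2" for x
  proof -
    have "lambert r (- r * (ue x)\<^sup>2) + r * lambert r (- (r ^ 3) * (ue x)\<^sup>2) = 1 / (1 + r * (ue x)\<^sup>2)"
      using lambert_rec[OF r *[OF that]] by (simp add: power2_eq_square power3_eq_cube mult_ac)
    then have "lambert r (- r * (ue x)\<^sup>2) = 1 / (1 + r * (ue x)\<^sup>2) - r * lambert r (- (r ^ 3) * (ue x)\<^sup>2)"
      by (simp add: algebra_simps)
    moreover have "s / (2 * \<i>) * (y / D) - s / (2 * \<i>) * (y * (r * m)) = s / (2 * \<i>) * (y * (1 / D - r * m))" for y D m
      by (simp add: right_diff_distrib)
    ultimately show ?thesis
      unfolding sd_polar_def sd_regular_def r_def[symmetric] s_def[symmetric] by (simp only:)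
  qed
  have ext: "2 * sd_ext \<tau> z = s / \<i> * (w * lambert r (- r * w\<^sup>2) - inverse w * lambert r (- r * inverse w ^ 2))"
  proof -
    have "sd_ext \<tau> z = (sd_polar \<tau> z - sd_regular \<tau> z) - (sd_polar \<tau> (- z) - sd_regular \<tau> (- z))"
      by (simp add: sd_ext_def)
    also have "\<dots> = s / (2 * \<i>) * (w * lambert r (- r * w\<^sup>2)) - s / (2 * \<i>) * (inverse w * lambert r (- r * inverse w ^ 2))"
      using half[of z] half[of "- z"] z by (simp add: ue_minus w_def)
    finally show ?thesis by (simp add: right_diff_distrib)
  qed
  have tm: "SD_term1 \<tau> z n = s / \<i> * (w * ((- r * w\<^sup>2) ^ n / (1 + r ^ (2 * n + 1)))
      - inverse w * ((- r * inverse w ^ 2) ^ n / (1 + r ^ (2 * n + 1))))" for n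
  proof -
    \<comment> \<open>These are exp (i pi (2n+1) z) and exp (i pi (n + 1/2) \<tau>), the
      exponentials in the sine and in the cosine of the n-th term.\<close>
    define X V where "X = w * (w\<^sup>2) ^ n" and "V = s * r ^ n"
    have [simp]: "X \<noteq> 0" "V \<noteq> 0" by (simp_all add: X_def V_def)
    have "ue ((2 * of_nat n + 1) * z) = X"
    proof -
      have "(2 * of_nat n + 1) * z = z + of_nat n * (2 * z)" by (simp add: algebra_simps)
      then show ?thesis by (simp only: ue_add ue_of_nat_mult X_def w_def ue_power2)
    qed
    then have sin: "sin ((2 * of_nat n + 1) * of_real pi * z) = (X - inverse X) / (2 * \<i>)"
      using sin_conv_ue[of "(2 * of_nat n + 1) * z"] by (simp add: mult_ac)
    have "ue ((of_nat n + 1 / 2) * \<tau>) = V"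
    proof -
      have "(of_nat n + 1 / 2) * \<tau> = \<tau> / 2 + of_nat n * \<tau>" by (simp add: algebra_simps)
      then show ?thesis by (simp only: ue_add ue_of_nat_mult V_def s_def r_def)
    qed
    then have cos: "cos ((of_nat n + 1 / 2) * of_real pi * \<tau>) = (V + inverse V) / 2"
      using cos_conv_ue[of "(of_nat n + 1 / 2) * \<tau>"] by (simp add: mult_ac)
    have V2: "V\<^sup>2 = r ^ (2 * n + 1)"
      by (simp add: V_def power_mult_distrib sr power_mult[symmetric] mult.commute)
    have nz: "1 + V\<^sup>2 \<noteq> 0" unfolding V2 by (rule one_plus_power_nonzero[OF r]) simp
    have 1: "(V + inverse V) / 2 = (1 + V\<^sup>2) / (2 * V)"
      by (simp add: field_simps power2_eq_square)
    have neg: "(- r * y) ^ n = (-1) ^ n * r ^ n * y ^ n" for y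
    proof -
      have "(- r * y) ^ n = ((-1) * r * y) ^ n" by simp
      then show ?thesis by (simp only: power_mult_distrib)
    qed
    have 2: "w * (- r * w\<^sup>2) ^ n = (-1) ^ n * r ^ n * X"
      unfolding neg X_def by (simp only: mult_ac)
    have "inverse X = inverse w * (inverse w ^ 2) ^ n"
      by (simp add: X_def power_inverse)
    then have 3: "inverse w * (- r * inverse w ^ 2) ^ n = (-1) ^ n * r ^ n * inverse X"
      unfolding neg by (simp only: mult_ac)
    have "SD_term1 \<tau> z n = (-1) ^ n * ((X - inverse X) / (2 * \<i>)) / ((1 + V\<^sup>2) / (2 * V))"
      unfolding SD_term1_def sin cos 1 ..
    also have "\<dots> = (-1) ^ n * V * (X - inverse X) / (\<i> * (1 + V\<^sup>2))"
    proof -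
      have "a * (b / (2 * \<i>)) / (c / (2 * V)) = a * V * b / (\<i> * c)" if "c \<noteq> 0" for a b c
        using that by (simp add: field_simps)
      from this[OF nz] show ?thesis .
    qed
    also have "\<dots> = s / \<i> * ((w * (- r * w\<^sup>2) ^ n - inverse w * (- r * inverse w ^ 2) ^ n) / (1 + V\<^sup>2))"
    proof -
      have "e * (s * R) * (A - B) / (\<i> * D) = s / \<i> * ((e * R * A - e * R * B) / D)" for e R A B D
        unfolding times_divide_times_eq by (simp add: algebra_simps)
      then show ?thesis unfolding 2 3 V_def .
    qed
    finally show ?thesis
      by (simp add: V2 diff_divide_distrib)
  qed
  have "norm (- r * inverse w ^ 2) < 1"
    using *[of "- z"] z by (simp only: ue_minus w_def uminus_complex.sel abs_minus_cancel)
  then show ?thesis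
    unfolding ext tm[abs_def] using *[OF z, folded w_def]
    by (intro sums_mult sums_diff lambert_sums[OF r])
qed

section \<open>Comparison of the product with the continued series\<close>

lemma sd_prod_minus_sd_ext_residue:
  assumes "z \<in> W"
  shows "(\<lambda>w. (w - z) * (sd_prod \<tau> w - sd_ext \<tau> w)) \<midarrow>z\<rightarrow> 0"
proof -
  have lim0: "(\<lambda>w. (w - z) * f w) \<midarrow>z\<rightarrow> 0" if "f analytic_on {z}" for f :: "complex \<Rightarrow> complex"
  proof -
    have "(\<lambda>w. (w - z) * f w) \<midarrow>z\<rightarrow> (z - z) * f z"
      using analytic_at_imp_isCont[OF that] by (intro tendsto_intros) (simp add: isCont_def)
    then show ?thesis by simp
  qed
  have reg: "(\<lambda>w. (w - z) * sd_regular \<tau> w) \<midarrow>z\<rightarrow> 0" "(\<lambda>w. (w - z) * sd_regular \<tau> (- w)) \<midarrow>z\<rightarrow> 0"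
    using assms analytic_on_subset[OF sd_regular_analytic] analytic_on_subset[OF sd_regular_analytic']
    by (auto intro!: lim0)
  \<comment> \<open>The regular parts contribute 0, so only the balance of three residues has to be
    checked at each point.\<close>
  have comb: ?thesis
    if "(\<lambda>w. (w - z) * sd_prod \<tau> w) \<midarrow>z\<rightarrow> a" "(\<lambda>w. (w - z) * sd_polar \<tau> w) \<midarrow>z\<rightarrow> b"
      "(\<lambda>w. (w - z) * sd_polar \<tau> (- w)) \<midarrow>z\<rightarrow> c" "a = b - c" for a b c
    using tendsto_diff[OF that(1) tendsto_diff[OF tendsto_diff[OF that(2,3)] tendsto_diff[OF reg]]] that(4)
    by (simp add: sd_ext_def algebra_simps)
  have inj: "n = n'" if "sd_pole \<tau> m n = sd_pole \<tau> m' n'" for m n m' n'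
  proof -
    have "Im (sd_pole \<tau> m n) = Im (sd_pole \<tau> m' n')" using that by simp
    then show ?thesis using \<tau> by (simp add: sd_pole_def)
  qed
  have np: "sd_pole \<tau> m 0 \<noteq> sd_pole \<tau> m' (-1)" for m m'
    using inj[of m 0 m' "-1"] by auto
  show ?thesis
  proof (cases "\<exists>m n. z = sd_pole \<tau> m n")
    case False
    then show ?thesis
      by (intro comb[of 0 0 0] lim0 sd_prod_analytic[OF \<tau>] sd_polar_analytic sd_polar_analytic') auto
  next
    case True
    then obtain m n where z: "z = sd_pole \<tau> m n" by blast
    \<comment> \<open>The imaginary part of a pole is (n + 1/2) Im \<tau>, so being in
      \<open>W\<close> leaves only the rows 0 and -1.\<close>
    have "\<bar>(of_int n + 1 / 2) * Im \<tau>\<bar> < 3 / 2 * Im \<tau>"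
      using assms by (simp add: z sd_pole_def W_def algebra_simps)
    then have "\<bar>of_int n + 1 / 2 :: real\<bar> < 3 / 2"
      using \<tau> by (simp add: abs_mult)
    then have "of_int (-2) < (of_int n :: real)" "of_int n < (of_int 1 :: real)" unfolding of_int_minus of_int_numeral of_int_1 of_int_0 by linarith+
    then have "n = 0 \<or> n = -1" unfolding of_int_less_iff by auto
    then show ?thesis
    proof
      assume n: "n = 0"
      show ?thesis
        by (rule comb[OF sd_prod_residue[OF \<tau>, of m n, folded z] lim0[OF sd_polar_analytic]
              sd_polar_residue'[of m, folded n, folded z[unfolded n, folded n]]])
           (use np z n in auto)
    next
      assume n: "n = -1"
      show ?thesis
        by (rule comb[OF sd_prod_residue[OF \<tau>, of m n, folded z] sd_polar_residue[of m, folded n, folded z]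
              lim0[OF sd_polar_analytic']])
           (use np[symmetric] z n in \<open>auto simp: power_int_diff\<close>)
    qed
  qed
qed

lemma not_sd_pole_strip:
  assumes z: "\<bar>Im z\<bar> < Im \<tau> / 2"
  shows "z \<noteq> sd_pole \<tau> m n"
proof
  assume "z = sd_pole \<tau> m n"
  then have "\<bar>(of_int n + 1 / 2) * Im \<tau>\<bar> < 1 / 2 * Im \<tau>"
    using z by (simp add: sd_pole_def algebra_simps)
  then have "\<bar>of_int n + 1 / 2 :: real\<bar> < 1 / 2"
    using \<tau> by (simp add: abs_mult)
  then have "of_int (-1) < (of_int n :: real)" "of_int n < (of_int 0 :: real)"
    unfolding of_int_minus of_int_numeral of_int_1 of_int_0 by linarith+
  then show False unfolding of_int_less_iff by simp
qed

lemma sd_prod_eq_sd_ext: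
  assumes z: "\<bar>Im z\<bar> < Im \<tau> / 2"
  shows "sd_prod \<tau> z = sd_ext \<tau> z"
proof -
  have zW: "z \<in> W" using z \<tau> by (simp add: W_def)
  note np = not_sd_pole_strip[OF z]
  have "sd_ext \<tau> analytic_on {z}"
    unfolding sd_ext_def
    using np zW analytic_on_subset[OF sd_regular_analytic] analytic_on_subset[OF sd_regular_analytic']
    by (intro analytic_intros sd_polar_analytic sd_polar_analytic') auto
  then have cont: "isCont (\<lambda>z. sd_prod \<tau> z - sd_ext \<tau> z) z"
    using sd_prod_analytic[OF \<tau>] np by (intro continuous_intros analytic_at_imp_isCont) auto
  have mero: "(\<lambda>z. sd_prod \<tau> z - sd_ext \<tau> z) meromorphic_on W"
  proof -
    have "sd_prod \<tau> meromorphic_on W"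
      using sd_prod_nicely_meromorphic[OF \<tau>] meromorphic_on_subset
      unfolding nicely_meromorphic_on_def by blast
    moreover have "sd_polar \<tau> meromorphic_on W" "(\<lambda>z. sd_polar \<tau> (- z)) meromorphic_on W"
      unfolding sd_polar_def
      by (intro meromorphic_intros analytic_on_imp_meromorphic_on analytic_intros)+
    moreover have "sd_regular \<tau> meromorphic_on W" "(\<lambda>z. sd_regular \<tau> (- z)) meromorphic_on W"
      using sd_regular_analytic sd_regular_analytic' by (auto intro: analytic_on_imp_meromorphic_on)
    ultimately show ?thesis
      unfolding sd_ext_def by (intro meromorphic_on_diff)
  qed
  have "sd_prod \<tau> z - sd_ext \<tau> z = 0"
    by (rule antiperiodic_eq_0[OF \<tau> mero[unfolded W_def] _ _ _ _ cont])
       (use zW sd_prod_minus_sd_ext_residue sd_ext_add_1 sd_ext_add_\<tau> sd_prod_add_1[OF \<tau>] sd_prod_add_\<tau>[OF \<tau>]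
        in \<open>auto simp: W_def\<close>)
  then show ?thesis by simp
qed

end

section \<open>The modular transformation and uniqueness\<close>

lemma Im_neg_inverse_pos: "Im \<tau> > 0 \<Longrightarrow> Im (- 1 / \<tau>) > 0"
  by (simp add: Im_divide sum_power2_gt_zero_iff)

text \<open>Division by \<tau> interchanges the two coordinates, and the sign in - 1/\<tau> reflects
  m + 1/2 to - m - 1/2 = (- m - 1) + 1/2.\<close>

lemma sd_pole_modular: "\<tau> \<noteq> 0 \<Longrightarrow> sd_pole \<tau> m n / \<tau> = sd_pole (- 1 / \<tau>) n (- m - 1)"
  by (simp add: sd_pole_def field_simps)

lemma sd_pole_modular_iff:
  assumes "\<tau> \<noteq> 0"
  shows "(\<exists>m n. z / \<tau> = sd_pole (- 1 / \<tau>) m n) \<longleftrightarrow> (\<exists>m n. z = sd_pole \<tau> m n)"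
proof
  assume "\<exists>m n. z / \<tau> = sd_pole (- 1 / \<tau>) m n"
  then obtain m n where "z / \<tau> = sd_pole (- 1 / \<tau>) m n" by blast
  also have "\<dots> = sd_pole \<tau> (- n - 1) m / \<tau>"
    using sd_pole_modular[OF assms, of "- n - 1" m] by simp
  finally show "\<exists>m n. z = sd_pole \<tau> m n" using assms by auto
qed (use sd_pole_modular[OF assms] in blast)

lemma sd_prod_modular:
  assumes \<tau>: "Im \<tau> > 0" and z: "\<And>m n. z \<noteq> sd_pole \<tau> m n"
  shows "sd_prod \<tau> z = - (1 / \<tau>) * sd_prod (- 1 / \<tau>) (z / \<tau>)"
proof -
  define \<tau>' where "\<tau>' = - 1 / \<tau>"
  have [simp]: "\<tau> \<noteq> 0" using \<tau> by auto
  have \<tau>': "Im \<tau>' > 0" using Im_neg_inverse_pos[OF \<tau>] by (simp add: \<tau>'_def)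
  note modular = sd_pole_modular[of \<tau>, folded \<tau>'_def] sd_pole_modular_iff[of \<tau>, folded \<tau>'_def]
  define W where "W = {z. \<bar>Im z\<bar> < 3 / 2 * Im \<tau>}"
  define g where "g = (\<lambda>z. sd_prod \<tau>' (z / \<tau>))"
  define f where "f = (\<lambda>z. sd_prod \<tau> z + 1 / \<tau> * g z)"
  \<comment> \<open>Division by \<tau> turns the translation by 1 into one by
    \<open>- \<tau>'\<close> and the translation by \<tau> into one by 1, so \<open>g\<close> has
    the antiperiods of \<open>sd_prod \<tau>\<close>.\<close>
  have g1: "g (z + 1) = - g z" for z
    using sd_prod_shift[OF \<tau>', of "z / \<tau>" 0 "-1"] by (simp add: g_def \<tau>'_def add_divide_distrib)
  have g\<tau>: "g (z + \<tau>) = - g z" for z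
    using sd_prod_add_1[OF \<tau>', of "z / \<tau>"] by (simp add: g_def add_divide_distrib)
  have f1: "f (z + 1) = - f z" for z
    using sd_prod_add_1[OF \<tau>, of z] by (simp add: f_def g1)
  have f\<tau>: "f (z + \<tau>) = - f z" for z
    using sd_prod_add_\<tau>[OF \<tau>, of z] by (simp add: f_def g\<tau>)
  have ana: "f analytic_on {z}" if "\<nexists>m n. z = sd_pole \<tau> m n" for z
  proof -
    have "sd_prod \<tau>' analytic_on {z / \<tau>}"
      using that modular(2)[of z] by (intro sd_prod_analytic[OF \<tau>']) auto
    then have "g analytic_on {z}"
      unfolding g_def
      by (intro analytic_on_compose_gen[of "\<lambda>z. z / \<tau>" "{z}" "sd_prod \<tau>'" "{z / \<tau>}", unfolded o_def] analytic_intros) auto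
    then show ?thesis
      unfolding f_def using that by (intro analytic_intros sd_prod_analytic[OF \<tau>]) auto
  qed
  have lim: "(\<lambda>w. (w - z) * f w) \<midarrow>z\<rightarrow> 0" for z
  proof (cases "\<exists>m n. z = sd_pole \<tau> m n")
    case False
    have "(\<lambda>w. (w - z) * f w) \<midarrow>z\<rightarrow> (z - z) * f z"
      using analytic_at_imp_isCont[OF ana[OF False]] by (intro tendsto_intros) (simp add: isCont_def)
    then show ?thesis by simp
  next
    case True
    then obtain m n where z: "z = sd_pole \<tau> m n" by blast
    have z': "z / \<tau> = sd_pole \<tau>' n (- m - 1)" by (simp add: z modular(1))
    have "filterlim (\<lambda>w. w / \<tau>) (at (z / \<tau>)) (at z)"
      by (intro filterlim_atI tendsto_intros) (auto simp: eventually_at_filter)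
    from filterlim_compose[OF sd_prod_residue[OF \<tau>', of n "- m - 1", folded z'] this]
    have 1: "(\<lambda>w. (w / \<tau> - z / \<tau>) * g w) \<midarrow>z\<rightarrow> (-1) powi (n + (- m - 1)) / (4 * pi * \<i>)"
      by (simp add: g_def)
    have 2: "(\<lambda>w. (w - z) * sd_prod \<tau> w) \<midarrow>z\<rightarrow> (-1) powi (m + n) / (4 * pi * \<i>)"
      using sd_prod_residue[OF \<tau>, of m n] by (simp add: z)
    \<comment> \<open>The factor 1/\<tau> in \<open>f\<close> is absorbed by the change of variable
      w / \<tau>, and the index - m - 1 of the transformed pole reverses the sign, so the residues
      cancel.\<close>
    have "(-1 :: complex) powi (n + (- m - 1)) = - ((-1) powi (m + n))"
      by (auto simp: power_int_minus_left)
    then have "(\<lambda>w. (w - z) * sd_prod \<tau> w + (w / \<tau> - z / \<tau>) * g w) \<midarrow>z\<rightarrow> 0"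
      using tendsto_add[OF 2 1] by simp
    then show ?thesis by (simp add: f_def algebra_simps diff_divide_distrib)
  qed
  have mero: "f meromorphic_on W"
  proof -
    have "sd_prod \<tau> meromorphic_on W"
      using sd_prod_nicely_meromorphic[OF \<tau>] meromorphic_on_subset
      unfolding nicely_meromorphic_on_def by blast
    moreover have "g meromorphic_on W"
      unfolding g_def sd_prod_def Let_def
      by (intro meromorphic_intros analytic_on_imp_meromorphic_on analytic_intros) (use norm_nome[OF \<tau>'] in auto)
    ultimately show ?thesis
      unfolding f_def by (intro meromorphic_intros)
  qed
  have shift: "f (z + of_int n * \<tau>) = 0 \<longleftrightarrow> f z = 0" for z n
  proof -
    have "f (z + of_nat n * \<tau>) = 0 \<longleftrightarrow> f z = 0" for z n
    proof (induction n)
      case (Suc n)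
      then show ?case using f\<tau>[of "z + of_nat n * \<tau>"] by (simp add: algebra_simps)
    qed auto
    from this[of z "nat n"] this[of "z + of_int n * \<tau>" "nat (- n)"] show ?thesis
      by (cases "n \<ge> 0") auto
  qed
  \<comment> \<open>\<open>antiperiodic_eq_0\<close> speaks only of points of \<open>W\<close>, so a
    multiple of \<tau> first brings the imaginary part into [0, Im \<tau>).\<close>
  define n where "n = - \<lfloor>Im z / Im \<tau>\<rfloor>"
  define z' where "z' = z + of_int n * \<tau>"
  have "z' \<in> W"
  proof -
    have "Im z' = frac (Im z / Im \<tau>) * Im \<tau>"
      using \<tau> by (simp add: z'_def n_def frac_def field_simps)
    moreover have "0 \<le> frac (Im z / Im \<tau>) * Im \<tau>" "frac (Im z / Im \<tau>) * Im \<tau> < 1 * Im \<tau>"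
      using \<tau> frac_lt_1[of "Im z / Im \<tau>"] frac_ge_0[of "Im z / Im \<tau>"]
      by (auto intro!: mult_strict_right_mono)
    ultimately show ?thesis using \<tau> by (simp add: W_def)
  qed
  have "\<nexists>i j. z' = sd_pole \<tau> i j"
  proof safe
    fix i j assume "z' = sd_pole \<tau> i j"
    then have "z = sd_pole \<tau> i (j - n)" by (simp add: z'_def sd_pole_def algebra_simps)
    with z show False by blast
  qed
  then have "isCont f z'" by (intro analytic_at_imp_isCont ana)
  then have "f z' = 0"
    using \<open>z' \<in> W\<close>
    by (intro antiperiodic_eq_0[OF \<tau> mero[unfolded W_def] lim f1 f\<tau>]) (auto simp: W_def)
  then have "f z = 0" using shift unfolding z'_def by blast
  then show ?thesis by (simp add: f_def g_def \<tau>'_def add_eq_0_iff2)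
qed

lemma sd_prod_is_SD:
  assumes \<tau>: "Im \<tau> > 0"
  shows "is_SD \<tau> (sd_prod \<tau>)"
proof -
  define \<tau>' where "\<tau>' = - 1 / \<tau>"
  have [simp]: "\<tau> \<noteq> 0" using \<tau> by auto
  have \<tau>': "Im \<tau>' > 0" using Im_neg_inverse_pos[OF \<tau>] by (simp add: \<tau>'_def)
  have series: "SD_term1 \<sigma> u sums (2 * sd_prod \<sigma> u)"
    if "Im \<sigma> > 0" "\<bar>Im u\<bar> < Im \<sigma> / 2" for \<sigma> u
    using sd_ext_series[OF that] sd_prod_eq_sd_ext[OF that] by simp
  have 1: "SD_term1 \<tau> z sums (2 * sd_prod \<tau> z)" if "\<bar>y\<bar> < 1 / 2" "z = of_real x + of_real y * \<tau>" for x y z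
  proof (rule series[OF \<tau>])
    have "\<bar>Im z\<bar> = \<bar>y\<bar> * Im \<tau>" using \<tau> by (simp add: that abs_mult)
    then show "\<bar>Im z\<bar> < Im \<tau> / 2"
      using mult_strict_right_mono[OF that(1) \<tau>] by simp
  qed
  have 2: "SD_term2 \<tau> z sums (- 2 * \<tau> * sd_prod \<tau> z)" if "\<bar>x\<bar> < 1 / 2" "z = of_real x + of_real y * \<tau>" for x y z
  proof -
    \<comment> \<open>The condition |x| < 1/2 is thus the condition of the first series for
      \<open>\<tau>'\<close> at \<open>z / \<tau>\<close>.\<close>
    have "z / \<tau> = of_real y - of_real x * \<tau>'"
      by (simp add: that \<tau>'_def field_simps)
    then have "\<bar>Im (z / \<tau>)\<bar> = \<bar>x\<bar> * Im \<tau>'" using \<tau>' by (simp add: abs_mult)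
    then have im: "\<bar>Im (z / \<tau>)\<bar> < Im \<tau>' / 2"
      using mult_strict_right_mono[OF that(1) \<tau>'] by simp
    have "\<nexists>m n. z = sd_pole \<tau> m n"
      using not_sd_pole_strip[OF \<tau>' im] sd_pole_modular_iff[of \<tau> z, folded \<tau>'_def] by auto
    then have "sd_prod \<tau> z = - (1 / \<tau>) * sd_prod \<tau>' (z / \<tau>)"
      using sd_prod_modular[OF \<tau>, of z] by (simp add: \<tau>'_def)
    moreover have "SD_term2 \<tau> z = SD_term1 \<tau>' (z / \<tau>)"
    proof
      fix n
      have "cos ((of_nat n + 1 / 2) * of_real pi * \<tau>') = cos ((of_nat n + 1 / 2) * of_real pi / \<tau>)"
        using cos_minus[of "(of_nat n + 1 / 2) * of_real pi / \<tau>"] by (simp add: \<tau>'_def)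
      then show "SD_term2 \<tau> z n = SD_term1 \<tau>' (z / \<tau>) n"
        by (simp add: SD_term1_def SD_term2_def)
    qed
    ultimately show ?thesis using series[OF \<tau>' im] by simp
  qed
  show ?thesis
    unfolding is_SD_def Let_def
    using sd_prod_nicely_meromorphic[OF \<tau>] 1[OF _ refl] 2[OF _ refl]
    by (auto simp: sums_iff)
qed

text \<open>The difference without its removable singularities vanishes near \<open>a\<close>, hence
  everywhere. So \<open>f\<close> and \<open>g\<close> agree on a punctured neighbourhood of every
  point and share limits and poles there, which determine the values of nicely meromorphic
  functions.\<close>

lemma nicely_meromorphic_eqI:
  assumes f: "f nicely_meromorphic_on UNIV" and g: "g nicely_meromorphic_on UNIV"
    and A: "open A" "a \<in> A" "\<And>z. z \<in> A \<Longrightarrow> f z = g z"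
  shows "f = g"
proof
  fix z
  let ?h = "remove_sings (\<lambda>z. f z - g z)"
  have mero: "(\<lambda>z. f z - g z) meromorphic_on UNIV"
    using f g unfolding nicely_meromorphic_on_def by (intro meromorphic_intros) auto
  then have iso: "isolated_singularity_at (\<lambda>z. f z - g z) w" for w
    using meromorphic_on_isolated_singularity meromorphic_on_subset by blast
  have ev: "eventually (\<lambda>w. ?h w = f w - g w) (at w)" for w
    using eventually_remove_sings_eq_at[OF iso] .
  have "eventually (\<lambda>w. ?h w = 0) (at a)"
    using ev[of a] eventually_at_in_open'[OF A(1,2)] by eventually_elim (simp add: A(3))
  then have "frequently (\<lambda>w. ?h w = 0) (at a)"
    by (intro eventually_frequently) auto
  then have h0: "?h w = 0" for w
    by (rule frequently_eq_meromorphic_imp_constant[OF _ remove_sings_nicely_meromorphic[OF mero]]) auto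
  have fg: "eventually (\<lambda>w. f w = g w) (at z)"
    using ev[of z] by eventually_elim (simp add: h0)
  have tl: "f \<midarrow>z\<rightarrow> c \<longleftrightarrow> g \<midarrow>z\<rightarrow> c" for c
    by (rule filterlim_cong[OF refl refl fg])
  have pl: "is_pole f z \<longleftrightarrow> is_pole g z"
    by (rule is_pole_cong[OF fg refl])
  have np: "\<not> is_pole u z" if "u \<midarrow>z\<rightarrow> c" for u :: "complex \<Rightarrow> complex" and c
    using that not_tendsto_and_filterlim_at_infinity[of "at z" u c] by (auto simp: is_pole_def)
  show "f z = g z"
    using f g tl pl np unfolding nicely_meromorphic_on_def
    by (metis UNIV_I at_neq_bot tendsto_unique)
qed

text \<open>The first series alone determines a function with \<open>is_SD\<close> on an open strip
  around 0, which yields the uniqueness behind \<open>THE\<close>.\<close>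

lemma SD_eq_sd_prod:
  assumes \<tau>: "Im \<tau> > 0"
  shows "SD z \<tau> = sd_prod \<tau> z"
proof -
  have "f = sd_prod \<tau>" if "is_SD \<tau> f" for f
  proof (rule nicely_meromorphic_eqI)
    let ?A = "{z. \<bar>Im z\<bar> < Im \<tau> / 2}"
    show "open ?A" by (intro open_Collect_less continuous_intros)
    show "0 \<in> ?A" using \<tau> by simp
    fix z assume "z \<in> ?A"
    then have y: "\<bar>Im z / Im \<tau>\<bar> < 1 / 2" using \<tau> by (simp add: field_simps)
    have z: "z = of_real (Re z - Im z / Im \<tau> * Re \<tau>) + of_real (Im z / Im \<tau>) * \<tau>"
      using \<tau> by (simp add: complex_eq_iff)
    have "u z = 1 / 2 * (\<Sum>n. SD_term1 \<tau> z n)" if "is_SD \<tau> u" for u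
      using that y z unfolding is_SD_def Let_def by metis
    then show "f z = sd_prod \<tau> z" using that sd_prod_is_SD[OF \<tau>] by metis
  qed (use that sd_prod_is_SD[OF \<tau>] in \<open>auto simp: is_SD_def\<close>)
  then have "(THE f. is_SD \<tau> f) = sd_prod \<tau>"
    using sd_prod_is_SD[OF \<tau>] by (intro the_equality)
  then show ?thesis by (simp add: SD_def)
qed

section \<open>From q-Pochhammer symbols back to the products of the theorem\<close>

lemma nome_pow_conv_ue: "nome_pow \<tau> s = ue (2 * of_real s * \<tau>)"
  by (simp add: nome_pow_def ue_def mult_ac)

lemma nome_pow_nat:
  "nome_pow \<tau> (real n + 1) = (ue \<tau>)\<^sup>2 * ((ue \<tau>)\<^sup>2) ^ n"
  "nome_pow \<tau> (real n + 1 / 2) = ue \<tau> * ((ue \<tau>)\<^sup>2) ^ n"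
  "nome_pow \<tau> (2 * real n + 2) = ue \<tau> ^ 4 * (ue \<tau> ^ 4) ^ n"
proof -
  have *: "ue (of_nat k * \<tau>) = ue \<tau> ^ k" for k by (rule ue_of_nat_mult)
  have "nome_pow \<tau> (real n + 1) = ue (of_nat (2 + 2 * n) * \<tau>)"
    "nome_pow \<tau> (real n + 1 / 2) = ue (of_nat (1 + 2 * n) * \<tau>)"
    "nome_pow \<tau> (2 * real n + 2) = ue (of_nat (4 + 4 * n) * \<tau>)"
    unfolding nome_pow_conv_ue by (simp_all add: algebra_simps)
  then show "nome_pow \<tau> (real n + 1) = (ue \<tau>)\<^sup>2 * ((ue \<tau>)\<^sup>2) ^ n"
    "nome_pow \<tau> (real n + 1 / 2) = ue \<tau> * ((ue \<tau>)\<^sup>2) ^ n"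
    "nome_pow \<tau> (2 * real n + 2) = ue \<tau> ^ 4 * (ue \<tau> ^ 4) ^ n"
    unfolding * by (simp_all add: power_add power_mult power2_eq_square)
qed

lemma prod_factor1_has_prod:
  assumes "Im \<tau> > 0"
  shows "prod_factor1 \<tau> has_prod sd_const (ue \<tau>)"
proof -
  have "prod_factor1 \<tau> = (\<lambda>n. (1 - ue \<tau> ^ 4 * (ue \<tau> ^ 4) ^ n)\<^sup>2 * (1 - ue \<tau> * ((ue \<tau>)\<^sup>2) ^ n)\<^sup>2)"
    unfolding prod_factor1_def nome_pow_nat ..
  then show ?thesis
    unfolding sd_const_def
    by (simp only:) (intro has_prod_mult has_prod_power qpoch_has_prod norm_nome assms)
qed

text \<open>The poles need no separate case: \<open>has_prod\<close> admits finitely many zero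
  factors, and with x / 0 = 0 a vanishing denominator makes both its factor and the value of the
  product 0.\<close>

lemma prod_factor2_has_prod:
  assumes "Im \<tau> > 0"
  shows "prod_factor2 \<tau> z has_prod
    ((qpoch ((ue \<tau>)\<^sup>2) ((ue \<tau>)\<^sup>2 * (ue z)\<^sup>2) * qpoch ((ue \<tau>)\<^sup>2) ((ue \<tau>)\<^sup>2 * inverse (ue z) ^ 2)) /
     (qpoch ((ue \<tau>)\<^sup>2) (- ue \<tau> * (ue z)\<^sup>2) * qpoch ((ue \<tau>)\<^sup>2) (- ue \<tau> * inverse (ue z) ^ 2)))"
    (is "_ has_prod ?P")
proof -
  have e: "exp (2 * \<i> * of_real pi * z) = (ue z)\<^sup>2" "exp (- 2 * \<i> * of_real pi * z) = inverse (ue z) ^ 2"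
    unfolding ue_minus[symmetric] ue_power2 by (simp_all add: ue_def mult_ac)
  have "prod_factor2 \<tau> z = (\<lambda>n.
     ((1 - ((ue \<tau>)\<^sup>2 * (ue z)\<^sup>2) * ((ue \<tau>)\<^sup>2) ^ n) * (1 - ((ue \<tau>)\<^sup>2 * inverse (ue z) ^ 2) * ((ue \<tau>)\<^sup>2) ^ n)) /
     ((1 - (- ue \<tau> * (ue z)\<^sup>2) * ((ue \<tau>)\<^sup>2) ^ n) * (1 - (- ue \<tau> * inverse (ue z) ^ 2) * ((ue \<tau>)\<^sup>2) ^ n)))"
    unfolding prod_factor2_def nome_pow_nat e by (simp add: mult_ac)
  also have "\<dots> has_prod ?P"
    by (intro has_prod_divide has_prod_mult qpoch_has_prod norm_nome assms)
  finally show ?thesis .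
qed

theorem mainTheorem10:
  fixes \<tau> :: complex
  assumes "Im \<tau> > 0"
  shows "convergent_prod (prod_factor1 \<tau>) \<and>
         (\<forall>z. convergent_prod (prod_factor2 \<tau> z) \<and>
              SD z \<tau> = sin (of_real pi * z) * nome_pow \<tau> (1/4) *
                (\<Prod>n. prod_factor1 \<tau> n) * (\<Prod>n. prod_factor2 \<tau> z n))"
proof -
  note P = prod_factor1_has_prod[OF assms, unfolded has_prod_iff]
    prod_factor2_has_prod[OF assms, unfolded has_prod_iff]
  have "nome_pow \<tau> (1/4) = ue (\<tau> / 2)" by (simp add: nome_pow_conv_ue)
  then show ?thesis
    using P by (simp add: SD_eq_sd_prod[OF assms] sd_prod_def Let_def sin_conv_ue)
qed

end
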